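(* Let $f\in\mathbb{Z}[X]$ be a monic irreducible polynomial of degree $d\geq 2$ which is even, i.e. $f(-X)=f(X)$. For integers $N\geq 1$ put $L_f(N)=\operatorname{lcm}\{f(1),\ldots,f(N)\}$. Then there is a constant $C>0$ depending only on $f$ such that for all integers $N\geq 2$, \[ \log L_f(N)\;\geq\;\frac{2(d-1)}{d}\,N\log N - C N . \] *)

theory Defs
  imports Complex_Main "HOL-Computational_Algebra.Computational_Algebra"
begin

text \<open>On \<^typ>\<open>int\<close>, the library's \<^term>\<open>Lcm\<close> is the nonnegative least common multiple, so signs
  of the values \<open>f(n)\<close> play no role; it is \<open>0\<close> if some value is \<open>0\<close>.\<close>

definition lcm_values :: "int poly \<Rightarrow> nat \<Rightarrow> int" where
  "lcm_values f N = Lcm ((\<lambda>n. poly f (int n)) ` {1..N})"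

definition even_poly :: "int poly \<Rightarrow> bool" where
  "even_poly f \<longleftrightarrow> pcompose f [:0, -1:] = f"

end

theory Submission
  imports Defs "HOL-Analysis.Convex" "HOL-Analysis.Summation_Tests" "Jordan_Normal_Form.Determinant"
begin

text \<open>Write \<open>d = degree f\<close>, let \<open>Q\<close> be the product of the \<open>\<bar>f(n)\<bar>\<close> for \<open>n \<le> N\<close> and let \<open>\<alpha>\<^sub>p\<close>, \<open>\<beta>\<^sub>p\<close> be the exponents
  of \<open>p\<close> in \<open>Q\<close> and in \<open>L\<^sub>f(N)\<close>. By growth, \<open>ln Q \<ge> d N ln N - O(N)\<close>. If \<open>\<rho>(p)\<close> is the number of
  roots of \<open>f\<close> modulo \<open>p\<close>, the primes \<open>p \<le> 2 N\<close> contribute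
  \<open>N \<Sum> \<rho>(p) ln p / p + O(N) \<le> N ln N + O(N)\<close> to \<open>ln Q\<close>. The remaining \<open>(d - 1) N ln N - O(N)\<close> comes from
  primes \<open>p > 2 N\<close>. For these at most \<open>d/2\<close> of the \<open>n \<le> N\<close> satisfy \<open>p dvd f(n)\<close>, because with \<open>n\<close>
  also \<open>-n\<close> is a root of the even polynomial \<open>f\<close>; hence \<open>\<alpha>\<^sub>p \<le> (d/2) \<beta>\<^sub>p\<close>.

  The Mertens-type bound \<open>\<Sum> \<rho>(p) ln p / p \<le> ln x + O(1)\<close> over \<open>p \<le> x\<close> needs no ideal theory:
  it follows from counting prime divisors of norms of differences of elements of a box in
  \<open>\<int>[X]/(f)\<close>.\<close>

section \<open>Chebyshev bounds\<close>

text \<open>Erdos's induction: an even \<open>n > 2\<close> adds no prime, and for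
  \<open>n = 2 * m + 1\<close> the primes in \<open>(m + 1, n]\<close> all divide
  \<open>n choose m\<close>, which is at most \<open>4 ^ m\<close>.\<close>

lemma prod_primes_le_four_power: "(\<Prod>p | prime p \<and> p \<le> n. p) \<le> (4::nat) ^ n"
proof (induction n rule: less_induct)
  case (less n)
  have fin: "finite {p::nat. prime p \<and> p \<le> m}" for m :: nat
    by (rule finite_subset[of _ "{..m}"]) auto
  consider "n < 2" | "n = 2" | "n > 2" "even n" | m where "n = 2 * m + 1" "m > 0"
    by (metis One_nat_def Suc_1 add_0 gr0I linorder_neqE_nat mult_0_right oddE one_less_numeral_iff semiring_norm(76))
  then show ?case
  proof cases
    case 1
    then have "{p. prime p \<and> p \<le> n} = {}" by (auto dest: prime_ge_2_nat)
    then show ?thesis by (simp del: Collect_empty_eq)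
  next
    case 2
    then have "{p. prime p \<and> p \<le> n} = {2}" by (auto intro: antisym dest: prime_ge_2_nat)
    then show ?thesis using 2 by simp
  next
    case 3
    then have "\<not> prime n" using prime_odd_nat by blast
    have "{p. prime p \<and> p \<le> n} = {p. prime p \<and> p \<le> n - 1}"
    proof (intro Collect_cong conj_cong refl)
      fix p :: nat assume "prime p"
      then have "p \<noteq> n" using \<open>\<not> prime n\<close> by auto
      then show "(p \<le> n) = (p \<le> n - 1)" using 3 by linarith
    qed
    then have "(\<Prod>p | prime p \<and> p \<le> n. p) \<le> 4 ^ (n - 1)" using less[of "n - 1"] 3 by simp
    also have "(4::nat) ^ (n - 1) \<le> 4 ^ n" by (intro power_increasing) auto
    finally show ?thesis .
  next
    case (4 m)
    define A where "A = {p. prime p \<and> m + 1 < p \<and> p \<le> n}"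
    have split: "{p. prime p \<and> p \<le> n} = {p. prime p \<and> p \<le> m + 1} \<union> A"
      using 4 by (auto simp: A_def)
    have finA: "finite A" unfolding A_def by (rule finite_subset[OF _ fin[of n]]) auto
    have ch: "(n choose m) * (fact m * fact (m + 1)) = fact n"
      using binomial_fact_lemma[of m n] 4 by (simp add: mult_ac)
    have "p dvd (n choose m)" if "p \<in> A" for p
    proof -
      have "prime p" "m + 1 < p" "p \<le> n" using that by (auto simp: A_def)
      then have "p dvd (n choose m) * (fact m * fact (m + 1))"
        unfolding ch by (simp add: prime_dvd_fact_iff)
      then show ?thesis using \<open>prime p\<close> \<open>m + 1 < p\<close>
        by (auto simp: prime_dvd_mult_iff prime_dvd_fact_iff simp del: fact_Suc)
    qed
    moreover have "coprime p q" if "p \<in> A" "q \<in> A" "p \<noteq> q" for p q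
      using that by (auto simp: A_def intro: primes_coprime)
    ultimately have "\<Prod>A dvd (n choose m)"
      using finA
    proof (induction A rule: infinite_finite_induct)
      case (insert q F)
      have "coprime q (\<Prod>F)" using insert by (intro prod_coprime_right) auto
      then show ?case using insert by (auto intro!: divides_mult)
    qed auto
    moreover have "n choose m > 0" using 4 by simp
    ultimately have "\<Prod>A \<le> (n choose m)" by (intro dvd_imp_le)
    also have "\<dots> \<le> 4 ^ m"
    proof -
      \<comment> \<open>The two equal middle entries of row \<open>n\<close> together are at most
        the row sum \<open>2 ^ n = 2 * 4 ^ m\<close>.\<close>
      have "n choose (m + 1) = n choose m"
        using binomial_symmetric[of m n] 4 by simp
      then have "2 * (n choose m) = (\<Sum>k\<in>{m, m+1}. n choose k)" by simp
      also have "\<dots> \<le> (\<Sum>k\<le>n. n choose k)" using 4 by (intro sum_mono2) auto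
      also have "\<dots> = 2 * 4 ^ m" unfolding choose_row_sum using 4 by (simp add: power_mult)
      finally show ?thesis by simp
    qed
    finally have "\<Prod>A \<le> 4 ^ m" .
    have "(\<Prod>p | prime p \<and> p \<le> n. p) = (\<Prod>p | prime p \<and> p \<le> m + 1. p) * \<Prod>A"
      unfolding split using finA fin by (subst prod.union_disjoint) (auto simp: A_def)
    also have "\<dots> \<le> 4 ^ (m + 1) * 4 ^ m"
      using less[of "m + 1"] 4 \<open>\<Prod>A \<le> 4 ^ m\<close> by (intro mult_mono) auto
    also have "\<dots> = 4 ^ n" using 4 by (simp add: power_add[symmetric] mult_2)
    finally show ?thesis .
  qed
qed

lemma finite_primes_le: "finite {p::nat. prime p \<and> p \<le> n}"
  by (rule finite_subset[of _ "{..n}"]) auto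

lemma sum_ln_primes_le: "(\<Sum>p | prime p \<and> p \<le> n. ln (real p)) \<le> real n * ln 4"
proof -
  have "(\<Sum>p | prime p \<and> p \<le> n. ln (real p)) = ln (\<Prod>p | prime p \<and> p \<le> n. real p)"
    by (subst ln_prod) (auto simp: finite_primes_le prime_gt_0_nat)
  also have "\<dots> \<le> ln (4 ^ n)"
  proof (subst ln_le_cancel_iff)
    show "(\<Prod>p | prime p \<and> p \<le> n. real p) \<le> 4 ^ n"
      using of_nat_mono[OF prod_primes_le_four_power[of n], where 'a = real] by simp
  qed (auto intro!: prod_pos simp: prime_gt_0_nat)
  finally show ?thesis by (simp add: ln_realpow)
qed

text \<open>At most \<open>sqrt n\<close> primes lie below \<open>sqrt n\<close>; every other prime
  contributes at least \<open>ln n / 2\<close> to the sum of \<open>ln p\<close>. This gives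
  \<open>card * ln n / 2 \<le> 2 n + n\<close>, hence the constant 6.\<close>

lemma card_primes_le:
  assumes "n \<ge> 1"
  shows "real (card {p. prime p \<and> p \<le> n}) * ln (real n) \<le> 6 * real n"
proof -
  let ?P = "{p. prime p \<and> p \<le> n}"
  have ln_sqrt: "ln (sqrt n) = ln (real n) / 2" using assms by (simp add: ln_sqrt)
  have "ln (real n) = 2 * ln (sqrt n)" by (simp add: ln_sqrt)
  also have "ln (sqrt n) \<le> sqrt n - 1" using assms by (intro ln_le_minus_one) auto
  finally have ln_le: "ln (real n) \<le> 2 * sqrt n" by simp
  have "real (card ?P) * (ln (real n) / 2) = (\<Sum>p\<in>?P. ln (sqrt n))" by (simp add: ln_sqrt)
  also have "\<dots> \<le> (\<Sum>p\<in>?P. ln (real p) + (if real p \<le> sqrt n then ln (sqrt n) else 0))"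
  proof (intro sum_mono)
    fix p assume "p \<in> ?P"
    then have "p \<ge> 1" by (auto dest: prime_ge_1_nat)
    then show "ln (sqrt n) \<le> ln (real p) + (if real p \<le> sqrt n then ln (sqrt n) else 0)"
      using assms by (auto intro!: ln_mono)
  qed
  also have "\<dots> = (\<Sum>p\<in>?P. ln (real p)) + (\<Sum>p | p \<in> ?P \<and> real p \<le> sqrt n. ln (sqrt n))"
    by (subst sum.distrib, subst sum.inter_filter[symmetric]) (auto simp: finite_primes_le)
  also have "(\<Sum>p | p \<in> ?P \<and> real p \<le> sqrt n. ln (sqrt n)) \<le> sqrt n * ln (sqrt n)"
  proof -
    have "{p. p \<in> ?P \<and> real p \<le> sqrt n} \<subseteq> {1..nat \<lfloor>sqrt n\<rfloor>}"
      by (auto dest: prime_ge_1_nat simp: le_nat_floor)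
    then have "card {p. p \<in> ?P \<and> real p \<le> sqrt n} \<le> card {1..nat \<lfloor>sqrt n\<rfloor>}"
      by (intro card_mono) auto
    then have "real (card {p. p \<in> ?P \<and> real p \<le> sqrt n}) \<le> real (nat \<lfloor>sqrt n\<rfloor>)"
      by (simp only: of_nat_le_iff card_atLeastAtMost diff_Suc_1)
    also have "\<dots> \<le> sqrt n" by (simp add: of_nat_floor)
    finally have "real (card {p. p \<in> ?P \<and> real p \<le> sqrt n}) * ln (sqrt n) \<le> sqrt n * ln (sqrt n)"
      using assms by (intro mult_right_mono) auto
    then show ?thesis by simp
  qed
  also have "\<dots> \<le> sqrt n * sqrt n" using ln_le ln_sqrt by (intro mult_left_mono) auto
  also have "(\<Sum>p\<in>?P. ln (real p)) \<le> real n * ln 4" by (rule sum_ln_primes_le)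
  also have "real n * ln 4 \<le> real n * 2"
    using ln_2_less_1 ln_realpow[of 2 2] by (intro mult_left_mono) auto
  finally show ?thesis by simp
qed

text \<open>Logarithm of the prime factorization. A set \<open>P\<close> that misses prime factors
  only lowers the sum, and primes not dividing \<open>m\<close> contribute 0.\<close>

lemma sum_multiplicity_ln_le:
  assumes "m > 0" "finite P" "\<And>p. p \<in> P \<Longrightarrow> prime p"
  shows "(\<Sum>p\<in>P. real (multiplicity p m) * ln (real p)) \<le> ln (real m)"
    and "(\<And>p. prime p \<Longrightarrow> p dvd m \<Longrightarrow> p \<in> P) \<Longrightarrow>
      (\<Sum>p\<in>P. real (multiplicity p m) * ln (real p)) = ln (real (m::nat))"
proof -
  have "real m = (\<Prod>p\<in>prime_factors m. real p ^ multiplicity p m)"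
    using arg_cong[OF prod_prime_factors[of m], of real] assms(1) by simp
  then have "ln (real m) = (\<Sum>p\<in>prime_factors m. ln (real p ^ multiplicity p m))"
    by (simp only:) (subst ln_prod, auto simp: prime_gt_0_nat in_prime_factors_iff)
  also have "\<dots> = (\<Sum>p\<in>prime_factors m. real (multiplicity p m) * ln (real p))"
    by (intro sum.cong) (auto simp: ln_realpow prime_gt_0_nat in_prime_factors_iff)
  finally have eq: "ln (real m) = \<dots>" .
  have z: "multiplicity p m = 0" if "p \<in> P - prime_factors m" for p
    using that assms by (auto simp: in_prime_factors_iff not_dvd_imp_multiplicity_0)
  have nn: "real (multiplicity p m) * ln (real p) \<ge> 0" if "p \<in> prime_factors m" for p
    using that by (auto simp: in_prime_factors_iff intro!: mult_nonneg_nonneg dest: prime_ge_1_nat)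
  have "(\<Sum>p\<in>P. real (multiplicity p m) * ln (real p)) =
    (\<Sum>p\<in>P \<inter> prime_factors m. real (multiplicity p m) * ln (real p))"
    using z assms(2) by (intro sum.mono_neutral_right) auto
  also have "\<dots> \<le> (\<Sum>p\<in>prime_factors m. real (multiplicity p m) * ln (real p))"
    using nn by (intro sum_mono2) auto
  finally show "(\<Sum>p\<in>P. real (multiplicity p m) * ln (real p)) \<le> ln (real m)" using eq by simp
  assume "\<And>p. prime p \<Longrightarrow> p dvd m \<Longrightarrow> p \<in> P"
  then have "prime_factors m \<subseteq> P" by (auto simp: in_prime_factors_iff)
  then show "(\<Sum>p\<in>P. real (multiplicity p m) * ln (real p)) = ln (real m)"
    unfolding eq using z assms(2) by (intro sum.mono_neutral_right) auto
qed

section \<open>The norm form\<close>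

text \<open>Change from the monomial basis to a Newton basis \<open>e\<^sub>j\<close> at the points \<open>x\<^sub>t\<close>; this is
  unimodular, and in the new basis the first \<open>k\<close> columns of \<open>M\<close> are divisible by \<open>p\<close>.\<close>

lemma prime_power_dvd_det:
  fixes M :: "int mat" and p :: int
  assumes M: "M \<in> carrier_mat n n" and p: "prime p"
    and k: "k \<le> n"
    and inc: "\<And>s t. s < t \<Longrightarrow> t < k \<Longrightarrow> \<not> p dvd x t - x s"
    and rows: "\<And>i t. i < n \<Longrightarrow> t < k \<Longrightarrow> p dvd (\<Sum>l<n. M $$ (i, l) * x t ^ l)"
  shows "p ^ k dvd det M"
proof -
  \<comment> \<open>Newton polynomials: the product over the first \<open>min j k\<close> points,
    padded by a power of \<open>X\<close> so that \<open>e j\<close> is monic of degree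
    \<open>j\<close> also for \<open>j > k\<close>. For \<open>j \<ge> k\<close> all
    \<open>k\<close> points are roots.\<close>
  define e :: "nat \<Rightarrow> int poly" where
    "e j = monom 1 (j - k) * (\<Prod>s<min j k. [:- x s, 1:])" for j
  have deg_lin: "degree (\<Prod>s<m. [:- x s, 1:]) = m" for m
    by (induction m) (auto simp: degree_mult_eq simp del: mult_pCons_right mult_pCons_left)
  have lead_lin: "lead_coeff (\<Prod>s<m. [:- x s, 1:]) = 1" for m
  proof (induction m)
    case (Suc m)
    then show ?case unfolding prod.lessThan_Suc lead_coeff_mult by simp
  qed simp
  have e_lead: "lead_coeff (e j) = 1" for j
    unfolding e_def lead_coeff_mult using lead_lin by (simp add: degree_monom_eq)
  have e_deg: "degree (e j) = j" for j
  proof -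
    have "degree (e j) = (j - k) + min j k"
      unfolding e_def using deg_lin[of "min j k"] 
      by (subst degree_mult_eq) (auto simp: degree_monom_eq)
    then show ?thesis by auto
  qed
  have e_root: "poly (e j) (x t) = 0" if "t < j" "t < k" for j t
    using that by (auto simp: e_def poly_prod poly_monom)
  have e_val: "poly (e t) (x t) = (\<Prod>s<t. x t - x s)" if "t < k" for t
    using that by (simp add: e_def poly_prod)
  define U where "U = mat n n (\<lambda>(j, l). coeff (e j) l)"
  have U: "U \<in> carrier_mat n n" by (simp add: U_def)
  have "det U = prod_list (diag_mat U)"
    by (rule det_lower_triangular[OF _ U]) (auto simp: U_def coeff_eq_0 e_deg)
  also have "\<dots> = 1"
    using e_lead e_deg by (auto simp: prod_list_diag_prod U_def intro!: prod.neutral)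
  finally have detU: "det U = 1" .
  \<comment> \<open>As \<open>det U = 1\<close>, the adjugate is the inverse of \<open>U\<close>;
    the rows of \<open>C\<close> are those of \<open>M\<close> in Newton coordinates.\<close>
  define C where "C = M * adj_mat U"
  have C: "C \<in> carrier_mat n n" using M adj_mat(1)[OF U] by (simp add: C_def)
  have CU: "C * U = M"
    unfolding C_def using M U adj_mat[OF U] detU
    by (subst assoc_mult_mat[of _ n n _ n _ n]) auto
  have Mil: "M $$ (i, l) = (\<Sum>j<n. C $$ (i, j) * coeff (e j) l)" if "i < n" "l < n" for i l
  proof -
    have "M $$ (i, l) = (C * U) $$ (i, l)" using CU by simp
    also have "\<dots> = (\<Sum>j<n. C $$ (i, j) * coeff (e j) l)"
      using that C U by (auto simp: times_mat_def scalar_prod_def U_def lessThan_atLeast0)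
    finally show ?thesis .
  qed
  have ev: "(\<Sum>l<n. coeff (e j) l * y ^ l) = poly (e j) y" if "j < n" for j y
    unfolding poly_altdef e_deg using that
    by (intro sum.mono_neutral_right) (auto simp: coeff_eq_0 e_deg)
  have row: "(\<Sum>l<n. M $$ (i, l) * y ^ l) = (\<Sum>j<n. C $$ (i, j) * poly (e j) y)" if "i < n" for i y
  proof -
    have "(\<Sum>l<n. M $$ (i, l) * y ^ l) = (\<Sum>l<n. \<Sum>j<n. C $$ (i, j) * (coeff (e j) l * y ^ l))"
      using that by (auto simp: Mil sum_distrib_right mult.assoc)
    also have "\<dots> = (\<Sum>j<n. \<Sum>l<n. C $$ (i, j) * (coeff (e j) l * y ^ l))"
      by (rule sum.swap)
    also have "\<dots> = (\<Sum>j<n. C $$ (i, j) * poly (e j) y)"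
      by (auto simp: sum_distrib_left[symmetric] ev)
    finally show ?thesis .
  qed
  \<comment> \<open>Evaluation at \<open>x t\<close> kills every \<open>e j\<close> with
    \<open>j > t\<close>, so the system is triangular. Its diagonal entry is a product of
    differences \<open>x t - x s\<close>, which is prime to \<open>p\<close>.\<close>
  have dvdC: "p dvd C $$ (i, t)" if "i < n" "t < k" for i t
    using that(2)
  proof (induction t rule: less_induct)
    case (less t)
    have "(\<Sum>j<n. C $$ (i, j) * poly (e j) (x t)) = (\<Sum>j\<le>t. C $$ (i, j) * poly (e j) (x t))"
      using less.prems k by (intro sum.mono_neutral_right) (auto simp: e_root)
    also have "\<dots> = (\<Sum>j<t. C $$ (i, j) * poly (e j) (x t)) + C $$ (i, t) * poly (e t) (x t)"
      by (simp add: lessThan_Suc_atMost[symmetric])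
    finally have eq: "(\<Sum>l<n. M $$ (i, l) * x t ^ l) = \<dots>"
      using row[OF that(1)] by simp
    have "p dvd (\<Sum>j<t. C $$ (i, j) * poly (e j) (x t))"
      using less by (intro dvd_sum) auto
    with rows[OF that(1) less.prems] have "p dvd C $$ (i, t) * poly (e t) (x t)"
      unfolding eq by (simp add: dvd_add_right_iff)
    moreover have "\<not> p dvd poly (e t) (x t)"
      unfolding e_val[OF less.prems] using inc less.prems p by (auto simp: prime_dvd_prod_iff)
    ultimately show ?case using p by (auto simp: prime_dvd_mult_iff)
  qed
  \<comment> \<open>Every Leibniz term takes one factor from each of the first \<open>k\<close>
    columns.\<close>
  have "p ^ k dvd (\<Prod>j<n. C $$ (q j, j))" if "q permutes {0..<n}" for q
  proof -
    have "q j < n" if "j < k" for j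
      using permutes_in_image[OF \<open>q permutes {0..<n}\<close>, of j] that k by auto
    then have "(\<Prod>j<k. p) dvd (\<Prod>j<k. C $$ (q j, j))"
      using dvdC by (intro prod_dvd_prod) auto
    also have "\<dots> dvd (\<Prod>j<n. C $$ (q j, j))"
      using k by (intro prod_dvd_prod_subset) auto
    finally show ?thesis by simp
  qed
  then have "p ^ k dvd det C"
    unfolding det_col[OF C] by (intro dvd_sum) auto
  also have "det C = det M"
    using det_mult[OF C U] detU CU by simp
  finally show ?thesis .
qed

text \<open>Leibniz expansion. The crude factor \<open>fact n\<close> is harmless, being absorbed
  into the constant \<open>K\<close> of \<open>norm_form\<close>.\<close>

lemma abs_det_le:
  fixes M :: "int mat"
  assumes M: "M \<in> carrier_mat n n" and b: "\<And>i j. i < n \<Longrightarrow> j < n \<Longrightarrow> \<bar>M $$ (i, j)\<bar> \<le> b"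
  shows "\<bar>det M\<bar> \<le> fact n * b ^ n"
proof -
  have "\<bar>det M\<bar> \<le> (\<Sum>p | p permutes {0..<n}. \<bar>signof p * (\<Prod>i=0..<n. M $$ (i, p i))\<bar>)"
    unfolding det_def'[OF M] by (rule sum_abs)
  also have "\<dots> \<le> (\<Sum>p | p permutes {0..<n}. b ^ n)"
  proof (rule sum_mono, clarify)
    fix p assume p: "p permutes {0..<n}"
    have "\<bar>signof p * (\<Prod>i=0..<n. M $$ (i, p i))\<bar> = (\<Prod>i=0..<n. \<bar>M $$ (i, p i)\<bar>)"
      by (simp add: abs_mult abs_prod sign_def)
    also have "\<dots> \<le> (\<Prod>i=0..<n. b)"
      using permutes_in_image[OF p] by (intro prod_mono) (auto intro!: b)
    finally show "\<bar>signof p * (\<Prod>i=0..<n. M $$ (i, p i))\<bar> \<le> b ^ n" by simp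
  qed
  also have "\<dots> = fact n * b ^ n"
    by (simp add: card_permutations)
  finally show ?thesis .
qed

text \<open>For monic \<open>f\<close> the scaling factor of pseudo-division is 1, so it is true
  division with remainder, available over the integers.\<close>

lemma monic_pseudo_mod:
  fixes f g :: "'a :: idom poly"
  assumes "lead_coeff f = 1" "degree f \<noteq> 0"
  shows "f dvd g - pseudo_mod g f" "degree (pseudo_mod g f) < degree f"
proof -
  have "f \<noteq> 0" using assms by auto
  obtain q where q: "pseudo_divmod g f = (q, pseudo_mod g f)"
    by (metis pseudo_mod_def prod.collapse)
  have "g - pseudo_mod g f = f * q"
    using pseudo_divmod(1)[OF \<open>f \<noteq> 0\<close> q] assms by (simp add: diff_eq_eq)
  then show "f dvd g - pseudo_mod g f" by simp
  show "degree (pseudo_mod g f) < degree f"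
    using pseudo_divmod(2)[OF \<open>f \<noteq> 0\<close> q] assms by auto
qed

text \<open>Lagrange's theorem modulo \<open>p\<close>: split off \<open>X - r\<close> for one root
  and induct, the remainder \<open>f(r)\<close> being divisible by \<open>p\<close>. The roots are
  arbitrary pairwise incongruent integers, so that negative representatives are allowed.\<close>

lemma card_roots_mod_prime_le:
  fixes f :: "int poly" and p :: int
  assumes "prime p" "lead_coeff f = 1" "finite R"
    and "\<And>r. r \<in> R \<Longrightarrow> p dvd poly f r"
    and "\<And>r s. r \<in> R \<Longrightarrow> s \<in> R \<Longrightarrow> p dvd r - s \<Longrightarrow> r = s"
  shows "card R \<le> degree f"
  using assms
proof (induction "degree f" arbitrary: f R)
  case 0
  then have "f = 1" by (metis degree_0_id lead_coeff_pCons(2) degree_eq_zeroE one_pCons pCons_0_0 degree_pCons_0 coeff_pCons_0)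
  then have "R = {}" using 0 by (auto simp: prime_ge_0_int)
  then show ?case by simp
next
  case (Suc n)
  show ?case
  proof (cases "R = {}")
    case False
    then obtain r where r: "r \<in> R" by blast
    define q where "q = synthetic_div f r"
    have f: "f = [:-r, 1:] * q + [:poly f r:]"
      using synthetic_div_correct'[of r f] by (simp add: q_def)
    have dq: "degree q = n" using Suc.hyps(2) by (simp add: q_def degree_synthetic_div)
    have "coeff f (Suc n) = coeff q n"
      by (subst f) (simp add: coeff_pCons dq coeff_eq_0 split: nat.split)
    then have lq: "lead_coeff q = 1" using Suc.prems(2) Suc.hyps(2) dq by simp
    have "card (R - {r}) \<le> degree q"
    proof (rule Suc.hyps(1))
      fix s assume s: "s \<in> R - {r}"
      have "poly f s = (s - r) * poly q s + poly f r"
        by (subst f) (simp add: algebra_simps)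
      with Suc.prems(4)[OF r] Suc.prems(4)[of s] s have "p dvd (s - r) * poly q s"
        by (simp add: dvd_add_left_iff)
      then show "p dvd poly q s"
        using Suc.prems(1,5) s r by (auto simp: prime_dvd_mult_iff)
    qed (use Suc.prems dq lq in auto)
    then show ?thesis using r Suc.prems(3) Suc.hyps(2) dq by simp
  qed simp
qed

text \<open>The integer \<open>n\<close> below is the norm of \<open>a(\<theta>)\<close> for a root \<open>\<theta>\<close> of \<open>f\<close>: the determinant of the
  matrix \<open>M\<close> of multiplication by \<open>a\<close> on \<open>\<int>[X]/(f)\<close> in the basis \<open>1, X, \<dots>, X\<^sup>d\<^sup>-\<^sup>1\<close>.\<close>

lemma norm_form:
  fixes f :: "int poly"
  assumes monic: "lead_coeff f = 1" and irr: "irreducible f" and deg: "degree f \<noteq> 0"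
  obtains K :: int where "K > 0"
    "\<And>a H. a \<noteq> 0 \<Longrightarrow> degree a < degree f \<Longrightarrow> (\<And>i. \<bar>coeff a i\<bar> \<le> H) \<Longrightarrow>
       \<exists>n. n \<noteq> 0 \<and> \<bar>n\<bar> \<le> K * H ^ degree f \<and>
         (\<forall>p R. prime p \<longrightarrow> R \<subseteq> {0..<p} \<longrightarrow> (\<forall>r\<in>R. p dvd poly f r \<and> p dvd poly a r) \<longrightarrow>
            p ^ card R dvd n) \<and>
         (\<exists>w. f dvd [:n:] - w * a)"
proof -
  define d where "d = degree f"
  define e where "e m = pseudo_mod (monom 1 m) f" for m
  \<comment> \<open>The exponents \<open>i + l\<close> with \<open>i, l < d\<close> stay below
    \<open>2 * d\<close>; the summand 1 keeps \<open>E\<close>, and so \<open>K\<close>,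
    positive.\<close>
  define E where "E = 1 + (\<Sum>m<2*d. \<Sum>j<d. \<bar>coeff (e m) j\<bar>)"
  have E1: "E \<ge> 1" by (auto simp: E_def intro!: sum_nonneg)
  have E: "\<bar>coeff (e m) j\<bar> \<le> E" if "m < 2 * d" "j < d" for m j
  proof -
    have "\<bar>coeff (e m) j\<bar> \<le> (\<Sum>j<d. \<bar>coeff (e m) j\<bar>)"
      using that by (intro member_le_sum) auto
    also have "\<dots> \<le> (\<Sum>m<2*d. \<Sum>j<d. \<bar>coeff (e m) j\<bar>)"
      using that by (intro member_le_sum[of m "{..<2*d}" "\<lambda>m. \<Sum>j<d. \<bar>coeff (e m) j\<bar>"]) (auto intro!: sum_nonneg)
    finally show ?thesis by (simp add: E_def)
  qed
  define K where "K = fact d * (int d * E) ^ d"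
  have "K > 0" using E1 deg by (simp add: K_def d_def)
  moreover have "\<exists>n. n \<noteq> 0 \<and> \<bar>n\<bar> \<le> K * H ^ d \<and>
         (\<forall>p R. prime p \<longrightarrow> R \<subseteq> {0..<p} \<longrightarrow> (\<forall>r\<in>R. p dvd poly f r \<and> p dvd poly a r) \<longrightarrow>
            p ^ card R dvd n) \<and>
         (\<exists>w. f dvd [:n:] - w * a)"
    if a: "a \<noteq> 0" "degree a < d" and H: "\<And>i. \<bar>coeff a i\<bar> \<le> H" for a H
  proof -
    \<comment> \<open>\<open>\<rho> i\<close> represents \<open>X^i * a\<close> modulo
      \<open>f\<close> in degree below \<open>d\<close>; it is row \<open>i\<close> of
      \<open>M\<close>.\<close>
    define \<rho> where "\<rho> i = (\<Sum>l<d. Polynomial.smult (coeff a l) (e (i + l)))" for i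
    define M where "M = mat d d (\<lambda>(i, j). coeff (\<rho> i) j)"
    have M: "M \<in> carrier_mat d d" by (simp add: M_def)
    have deg_e: "degree (e m) < d" for m
      using monic_pseudo_mod(2)[OF monic deg] by (simp add: e_def d_def)
    have deg_\<rho>: "coeff (\<rho> i) j = 0" if "j \<ge> d" for i j
      using that deg_e by (auto simp: \<rho>_def coeff_sum intro!: sum.neutral coeff_eq_0) (metis le_trans not_le)
    have a_eq: "a = (\<Sum>l<d. monom (coeff a l) l)"
      using a by (intro poly_eqI) (auto simp: coeff_sum coeff_eq_0)
    have cong: "f dvd monom 1 i * a - \<rho> i" for i
    proof -
      have "monom 1 i * a - \<rho> i = (\<Sum>l<d. Polynomial.smult (coeff a l) (monom 1 (i + l) - e (i + l)))"
        by (subst a_eq) (simp add: \<rho>_def sum_distrib_left mult_monom sum_subtractf smult_diff_right smult_monom)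
      moreover have "f dvd \<dots>"
        using monic_pseudo_mod(1)[OF monic deg] by (intro dvd_sum dvd_smult) (simp add: e_def)
      ultimately show ?thesis by simp
    qed
    have "\<bar>M $$ (i, j)\<bar> \<le> int d * (H * E)" if "i < d" "j < d" for i j
    proof -
      have "0 \<le> H" using H[of 0] by simp
      have "\<bar>M $$ (i, j)\<bar> \<le> (\<Sum>l<d. \<bar>coeff a l\<bar> * \<bar>coeff (e (i + l)) j\<bar>)"
        using that by (auto simp: M_def \<rho>_def coeff_sum abs_mult[symmetric] intro!: sum_abs)
      also have "\<dots> \<le> (\<Sum>l<d. H * E)"
        using that H E \<open>0 \<le> H\<close> by (intro sum_mono mult_mono) auto
      finally show ?thesis by simp
    qed
    from abs_det_le[OF M this] have "\<bar>det M\<bar> \<le> K * H ^ d"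
      by (simp add: K_def power_mult_distrib mult_ac)
    \<comment> \<open>A left kernel vector of \<open>M\<close> would be the coefficient vector of a
      nonzero \<open>w\<close> of degree below \<open>d\<close> with \<open>f dvd w * a\<close>.
      Since \<open>f\<close> is prime, it would divide \<open>w\<close> or \<open>a\<close>, both
      nonzero and of smaller degree.\<close>
    moreover have "det M \<noteq> 0"
    proof
      assume "det M = 0"
      then have "det M\<^sup>T = 0" using det_transpose[OF M] by simp
      then obtain v where v: "v \<in> carrier_vec d" "v \<noteq> 0\<^sub>v d" "M\<^sup>T *\<^sub>v v = 0\<^sub>v d"
        using det_0_iff_vec_prod_zero[of "M\<^sup>T" d] M by auto
      define w where "w = (\<Sum>i<d. monom (v $ i) i)"
      have cw: "coeff w j = (if j < d then v $ j else 0)" for j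
        by (auto simp: w_def coeff_sum)
      obtain i where "i < d" "v $ i \<noteq> 0" using v(1,2) by (metis eq_vecI carrier_vecD index_zero_vec)
      then have "w \<noteq> 0" using cw[of i] by auto
      have "degree w < d" using deg by (intro degree_lessI) (auto simp: cw d_def)
      have "(\<Sum>i<d. v $ i * coeff (\<rho> i) j) = 0" for j
      proof (cases "j < d")
        case True
        then have "(\<Sum>i<d. v $ i * coeff (\<rho> i) j) = (M\<^sup>T *\<^sub>v v) $ j"
          using v(1) by (auto simp: M_def scalar_prod_def lessThan_atLeast0 mult.commute)
        then show ?thesis using v(3) True by simp
      qed (auto simp: deg_\<rho>)
      then have "(\<Sum>i<d. Polynomial.smult (v $ i) (\<rho> i)) = 0"
        by (intro poly_eqI) (simp add: coeff_sum)
      moreover have "w * a - (\<Sum>i<d. Polynomial.smult (v $ i) (\<rho> i)) = (\<Sum>i<d. Polynomial.smult (v $ i) (monom 1 i * a - \<rho> i))"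
        by (simp add: w_def sum_distrib_right sum_subtractf smult_diff_right smult_monom flip: mult_smult_left)
      moreover have "f dvd \<dots>" by (intro dvd_sum dvd_smult cong)
      ultimately have "f dvd w * a" by simp
      then have "f dvd w \<or> f dvd a"
        using irr by (simp add: prime_elem_dvd_mult_iff irreducible_imp_prime_elem)
      then show False
        using dvd_imp_degree_le[of f] \<open>w \<noteq> 0\<close> \<open>degree w < d\<close> a unfolding d_def by force
    qed
    \<comment> \<open>Row 0 of \<open>adj_mat M * M = det M * I\<close> writes the constant
      \<open>det M\<close> as a combination of the \<open>\<rho> i\<close>, hence as a multiple of
      \<open>a\<close> modulo \<open>f\<close>.\<close>
    moreover have "\<exists>w. f dvd [:det M:] - w * a"
    proof -
      define c where "c i = adj_mat M $$ (0, i)" for i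
      have adj: "adj_mat M \<in> carrier_mat d d" "adj_mat M * M = det M \<cdot>\<^sub>m 1\<^sub>m d" using adj_mat[OF M] by auto
      have "(\<Sum>i<d. c i * coeff (\<rho> i) j) = coeff [:det M:] j" for j
      proof (cases "j < d")
        case True
        have "(\<Sum>i<d. c i * coeff (\<rho> i) j) = (adj_mat M * M) $$ (0, j)"
          using adj(1) M True deg
          by (auto simp: c_def M_def d_def times_mat_def scalar_prod_def lessThan_atLeast0)
        then show ?thesis using True deg unfolding adj(2) by (simp add: coeff_pCons d_def split: nat.split)
      next
        case False
        then have "j \<noteq> 0" using deg by (auto simp: d_def)
        with False show ?thesis by (simp add: deg_\<rho> coeff_pCons split: nat.split)
      qed
      then have "[:det M:] = (\<Sum>i<d. Polynomial.smult (c i) (\<rho> i))"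
        by (intro poly_eqI) (simp add: coeff_sum)
      then have "(\<Sum>i<d. monom (c i) i) * a - [:det M:] = (\<Sum>i<d. Polynomial.smult (c i) (monom 1 i * a - \<rho> i))"
        by (simp add: sum_distrib_right sum_subtractf smult_diff_right smult_monom flip: mult_smult_left)
      moreover have "f dvd \<dots>" by (intro dvd_sum dvd_smult cong)
      ultimately have "f dvd [:det M:] - (\<Sum>i<d. monom (c i) i) * a"
        by (metis dvd_minus_iff minus_diff_eq)
      then show ?thesis by blast
    qed
    \<comment> \<open>At a common root of \<open>f\<close> and \<open>a\<close> modulo
      \<open>p\<close> each row polynomial \<open>\<rho> i\<close> vanishes modulo \<open>p\<close>,
      so \<open>prime_power_dvd_det\<close> applies with the elements of \<open>R\<close> as
      points.\<close>
    moreover have "p ^ card R dvd det M"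
      if p: "prime p" and R: "R \<subseteq> {0..<p}" and dvd: "\<forall>r\<in>R. p dvd poly f r \<and> p dvd poly a r" for p R
    proof -
      have "finite R" using R finite_subset by blast
      have inj: "r = s" if "r \<in> R" "s \<in> R" "p dvd r - s" for r s
        using that R by (metis atLeastLessThan_iff mod_eq_dvd_iff mod_pos_pos_trivial subsetD)
      have "card R \<le> d"
        unfolding d_def using p monic \<open>finite R\<close> dvd inj by (intro card_roots_mod_prime_le) auto
      obtain x where x: "bij_betw x {..<card R} R"
        using ex_bij_betw_nat_finite[OF \<open>finite R\<close>] by (auto simp: lessThan_atLeast0)
      have xR: "x t \<in> R" if "t < card R" for t
        using x that by (auto simp: bij_betw_def)
      show ?thesis
      proof (rule prime_power_dvd_det[OF M p \<open>card R \<le> d\<close>, where x = x])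
        fix s t assume st: "s < t" "t < card R"
        show "\<not> p dvd x t - x s"
        proof
          assume "p dvd x t - x s"
          then have "x t = x s" using inj xR st by simp
          moreover have "inj_on x {..<card R}" using x by (simp add: bij_betw_def)
          ultimately show False using st by (auto dest: inj_onD)
        qed
      next
        fix i t assume it: "i < d" "t < card R"
        obtain c where c: "monom 1 i * a - \<rho> i = f * c" using cong[of i] by (auto elim: dvdE)
        have "poly (\<rho> i) (x t) = poly (monom 1 i * a - (monom 1 i * a - \<rho> i)) (x t)" by simp
        also have "\<dots> = poly (monom 1 i) (x t) * poly a (x t) - poly f (x t) * poly c (x t)"
          unfolding c by simp
        finally have "p dvd poly (\<rho> i) (x t)"
          using dvd xR[OF it(2)] by simp
        also have "poly (\<rho> i) (x t) = (\<Sum>l<d. M $$ (i, l) * x t ^ l)"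
        proof -
          have "\<rho> i = (\<Sum>l<d. monom (coeff (\<rho> i) l) l)"
            by (intro poly_eqI) (auto simp: coeff_sum deg_\<rho>)
          then have "poly (\<rho> i) (x t) = poly (\<Sum>l<d. monom (coeff (\<rho> i) l) l) (x t)" by simp
          then show ?thesis using it by (simp add: poly_sum poly_monom M_def)
        qed
        finally show "p dvd (\<Sum>l<d. M $$ (i, l) * x t ^ l)" .
      qed
    qed
    ultimately show ?thesis by blast
  qed
  ultimately show ?thesis using that unfolding d_def by blast
qed

section \<open>A Mertens-type bound for roots modulo primes\<close>

text \<open>Cauchy-Schwarz over the \<open>p\<close> fibres of \<open>g\<close>: their sizes sum to
  \<open>card B\<close>, and their squares count the colliding pairs, diagonal included.\<close>

lemma card_collisions:
  fixes p :: nat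
  assumes "finite B" "g ` B \<subseteq> {0..<int p}"
  shows "card B ^ 2 \<le> p * card {(a, b). a \<in> B \<and> b \<in> B \<and> g a = g b}"
proof -
  let ?F = "\<lambda>i. {a \<in> B. g a = i}"
  have "B = (\<Union>i\<in>{0..<int p}. ?F i)" using assms by auto
  then have "card B = card (\<Union>i\<in>{0..<int p}. ?F i)" by simp
  also have "\<dots> = (\<Sum>i\<in>{0..<int p}. card (?F i))"
    using assms by (subst card_UN_disjoint) auto
  finally have 1: "card B = \<dots>" .
  have "{(a, b). a \<in> B \<and> b \<in> B \<and> g a = g b} = (\<Union>i\<in>{0..<int p}. ?F i \<times> ?F i)"
    using assms by auto
  then have "card {(a, b). a \<in> B \<and> b \<in> B \<and> g a = g b} = card (\<Union>i\<in>{0..<int p}. ?F i \<times> ?F i)"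
    by simp
  also have "\<dots> = (\<Sum>i\<in>{0..<int p}. card (?F i) ^ 2)"
    using assms by (subst card_UN_disjoint) (auto simp: power2_eq_square card_cartesian_product)
  finally have 2: "card {(a, b). a \<in> B \<and> b \<in> B \<and> g a = g b} = \<dots>" .
  have "(\<Sum>i\<in>{0..<int p}. real (card (?F i)))\<^sup>2 \<le> (\<Sum>i\<in>{0..<int p}. (real (card (?F i)))\<^sup>2) * real (card {0..<int p})"
    by (rule sum_squared_le_sum_of_squares)
  then have "real ((card B)\<^sup>2) \<le> real (p * card {(a, b). a \<in> B \<and> b \<in> B \<and> g a = g b})"
    unfolding 1 2 by (simp add: mult.commute)
  then show ?thesis by (simp only: of_nat_le_iff)
qed

lemma ex_coeff_box:
  assumes "d > 0"
  obtains B :: "int poly set" where "finite B" "card B = H ^ d"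
    "\<And>a. a \<in> B \<Longrightarrow> degree a < d" "\<And>a i. a \<in> B \<Longrightarrow> 0 \<le> coeff a i \<and> coeff a i \<le> int H"
proof -
  define \<phi> where "\<phi> c = (\<Sum>i<d. monom (c i :: int) i)" for c
  let ?S = "{..<d} \<rightarrow>\<^sub>E {0..<int H}"
  have c: "coeff (\<phi> c) i = (if i < d then c i else 0)" for c i
    by (auto simp: \<phi>_def coeff_sum)
  have "inj_on \<phi> ?S"
  proof (rule inj_onI)
    fix c c' assume cc: "c \<in> ?S" "c' \<in> ?S" "\<phi> c = \<phi> c'"
    show "c = c'"
    proof (rule PiE_ext[OF cc(1,2)])
      fix i assume "i \<in> {..<d}"
      then show "c i = c' i" using arg_cong[OF cc(3), of "\<lambda>a. coeff a i"] by (simp add: c)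
    qed
  qed
  then have "card (\<phi> ` ?S) = H ^ d" by (simp add: card_image card_PiE)
  moreover have "finite (\<phi> ` ?S)" by (intro finite_imageI finite_PiE) auto
  moreover have "degree a < d" if a: "a \<in> \<phi> ` ?S" for a
  proof -
    obtain x where "a = \<phi> x" using a by blast
    then show ?thesis using assms by (intro degree_lessI) (auto simp: c)
  qed
  moreover have "0 \<le> coeff a i \<and> coeff a i \<le> int H" if a: "a \<in> \<phi> ` ?S" for a i
  proof -
    obtain x where x: "x \<in> ?S" "a = \<phi> x" using a by blast
    have "x i \<in> {0..<int H}" if "i < d" using PiE_mem[OF x(1), of i] that by simp
    then show ?thesis unfolding x(2) c by auto
  qed
  ultimately show ?thesis using that by blast
qed

text \<open>Its cardinality is the \<rho>(p) of the overview.\<close>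

definition roots_mod :: "int poly \<Rightarrow> nat \<Rightarrow> int set" where
  "roots_mod f p = {r \<in> {0..<int p}. int p dvd poly f r}"

lemma finite_roots_mod [simp]: "finite (roots_mod f p)"
  unfolding roots_mod_def by (rule finite_subset[of _ "{0..<int p}"]) auto

lemma residue_eqI: "\<lbrakk>r \<in> {0..<p}; s \<in> {0..<p}; p dvd r - s\<rbrakk> \<Longrightarrow> r = (s :: int)"
  by (metis atLeastLessThan_iff mod_eq_dvd_iff mod_pos_pos_trivial)

lemma card_roots_mod_le:
  assumes "prime p" "lead_coeff f = 1"
  shows "card (roots_mod f p) \<le> degree f"
    using assms
  by (intro card_roots_mod_prime_le[of "int p"] finite_roots_mod) (auto simp: roots_mod_def intro: residue_eqI)

text \<open>\<open>card_collisions\<close> for evaluation at \<open>r\<close> modulo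
  \<open>p\<close>; the subtracted \<open>card B\<close> accounts for the diagonal pairs.\<close>

lemma card_box_collisions_ge:
  fixes B :: "int poly set"
  assumes "finite B" "p > 0"
  shows "real (card {(a, b). a \<in> B \<and> b \<in> B \<and> a \<noteq> b \<and> int p dvd poly (a - b) r})
    \<ge> real (card B) ^ 2 / real p - real (card B)"
proof -
  let ?T = "{(a, b). a \<in> B \<and> b \<in> B \<and> a \<noteq> b \<and> int p dvd poly (a - b) r}"
  have "card B ^ 2 \<le> p * card {(a, b). a \<in> B \<and> b \<in> B \<and> poly a r mod int p = poly b r mod int p}"
    using assms by (intro card_collisions) auto
  also have "{(a, b). a \<in> B \<and> b \<in> B \<and> poly a r mod int p = poly b r mod int p} = ?T \<union> (\<lambda>a. (a, a)) ` B"
    by (auto simp: mod_eq_dvd_iff)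
  also have "card \<dots> \<le> card ?T + card B"
    using card_image_le[OF assms(1), of "\<lambda>a. (a, a)"] by (intro order.trans[OF card_Un_le]) simp
  finally have "card B ^ 2 \<le> p * (card ?T + card B)" using assms(2) by simp
  then have "real (card B ^ 2) \<le> real (p * (card ?T + card B))" by (simp only: of_nat_le_iff)
  then show ?thesis using assms(2) by (simp add: field_simps)
qed

text \<open>Sum \<open>ln \<bar>Norm (u - v)\<bar>\<close> over all pairs \<open>u \<noteq> v\<close> in a coefficient box \<open>B\<close> with
  \<open>card B = H\<^sup>d \<approx> x\<close>. Each term is at most \<open>d ln H + O(1)\<close>, while by Cauchy-Schwarz at least
  a proportion \<open>1/p\<close> of all pairs agree at a given root \<open>r\<close> of \<open>f\<close> modulo \<open>p\<close>.\<close>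

lemma sum_roots_mod_ln_le:
  fixes f :: "int poly"
  assumes monic: "lead_coeff f = 1" and irr: "irreducible f" and deg: "degree f \<noteq> 0"
  shows "\<exists>C. \<forall>x\<ge>1. (\<Sum>p | prime p \<and> p \<le> x. real (card (roots_mod f p)) * ln (real p) / real p) \<le> ln (real x) + C"
proof -
  define d where "d = degree f"
  have d: "d > 0" using deg by (simp add: d_def)
  obtain K :: int where K: "K > 0" and norm: "\<And>a H. a \<noteq> 0 \<Longrightarrow> degree a < d \<Longrightarrow> (\<And>i. \<bar>coeff a i\<bar> \<le> H) \<Longrightarrow>
       \<exists>n. n \<noteq> 0 \<and> \<bar>n\<bar> \<le> K * H ^ d \<and>
         (\<forall>p R. prime p \<longrightarrow> R \<subseteq> {0..<p} \<longrightarrow> (\<forall>r\<in>R. p dvd poly f r \<and> p dvd poly a r) \<longrightarrow>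
            p ^ card R dvd n)"
    using norm_form[OF assms] unfolding d_def by metis
  have "(\<Sum>p | prime p \<and> p \<le> x. real (card (roots_mod f p)) * ln (real p) / real p)
    \<le> ln (real x) + (ln K + d * ln 2 + d * ln 4)" if x: "x \<ge> 1" for x
  proof -
    let ?P = "{p. prime p \<and> p \<le> x}"
    \<comment> \<open>Minimality gives \<open>(H - 1) ^ d < x\<close>, and doubling
      \<open>H - 1\<close> reaches \<open>H\<close> unless \<open>H = 1\<close>; so
      \<open>H ^ d\<close> lies between \<open>x\<close> and \<open>2 ^ d * x\<close>.\<close>
    define H where "H = (LEAST h. x \<le> h ^ d)"
    have "x \<le> x ^ d" using x d by (simp add: self_le_power)
    then have H: "x \<le> H ^ d" unfolding H_def by (rule LeastI)
    have "H > 0" using H x d by (intro gr0I) (auto simp: zero_power)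
    have "(H - 1) ^ d < x"
      using not_less_Least[of "H - 1" "\<lambda>h. x \<le> h ^ d"] \<open>H > 0\<close> by (simp add: H_def not_le)
    have H_le: "H ^ d \<le> 2 ^ d * x"
    proof (cases "H = 1")
      case False
      then have "H \<le> 2 * (H - 1)" using \<open>H > 0\<close> by linarith
      then have "H ^ d \<le> (2 * (H - 1)) ^ d" by (intro power_mono) auto
      also have "\<dots> \<le> 2 ^ d * x" using \<open>(H - 1) ^ d < x\<close> by (simp add: power_mult_distrib)
      finally show ?thesis .
    qed (use x in simp)
    obtain B :: "int poly set" where B: "finite B" "card B = H ^ d"
      "\<And>a. a \<in> B \<Longrightarrow> degree a < d" "\<And>a i. a \<in> B \<Longrightarrow> 0 \<le> coeff a i \<and> coeff a i \<le> int H"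
      using ex_coeff_box[OF d] by metis
    define b where "b = real (card B)"
    have b: "b > 0" "real x \<le> b" "b \<le> 2 ^ d * real x"
      using \<open>H > 0\<close> B(2) H H_le of_nat_mono[OF H_le, where 'a = real] of_nat_mono[OF H, where 'a = real]
      by (auto simp: b_def)
    define T where "T = {(u, v). u \<in> B \<and> v \<in> B \<and> u \<noteq> v}"
    have finT: "finite T" by (rule finite_subset[of _ "B \<times> B"]) (auto simp: T_def B)
    have "card T \<le> card (B \<times> B)" using B(1) by (intro card_mono) (auto simp: T_def)
    then have cardT: "real (card T) \<le> b ^ 2"
      unfolding card_cartesian_product b_def by (simp add: power2_eq_square flip: of_nat_mult)
    define L where "L = ln K + d * ln 2 + ln (real x)"
    have "L \<ge> 0" using K x by (simp add: L_def)
    \<comment> \<open>For a fixed pair, the common roots of \<open>f\<close> and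
      \<open>u - v\<close> modulo \<open>p\<close> number at most the exponent of \<open>p\<close>
      in the norm of \<open>u - v\<close>, and the logarithm of that norm is at most
      \<open>L\<close>.\<close>
    have pair: "(\<Sum>p\<in>?P. (\<Sum>r\<in>roots_mod f p. if int p dvd poly (u - v) r then ln (real p) else 0)) \<le> L"
      if uv: "(u, v) \<in> T" for u v
    proof -
      have "\<bar>coeff (u - v) i\<bar> \<le> int H" for i
        using uv B(4)[of u i] B(4)[of v i] by (auto simp: T_def)
      moreover have "u - v \<noteq> 0" "degree (u - v) < d"
        using uv B(3) by (auto simp: T_def intro: degree_diff_less)
      ultimately obtain n where n: "n \<noteq> 0" "\<bar>n\<bar> \<le> K * int H ^ d" and
        ndvd: "\<And>p R. prime p \<Longrightarrow> R \<subseteq> {0..<p} \<Longrightarrow> (\<forall>r\<in>R. p dvd poly f r \<and> p dvd poly (u - v) r) \<Longrightarrow>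
            p ^ card R dvd n" using norm by meson
      define m where "m = nat \<bar>n\<bar>"
      have m: "m > 0" using n by (simp add: m_def)
      have "(\<Sum>p\<in>?P. (\<Sum>r\<in>roots_mod f p. if int p dvd poly (u - v) r then ln (real p) else 0))
        \<le> (\<Sum>p\<in>?P. real (multiplicity p m) * ln (real p))"
      proof (rule sum_mono)
        fix p assume p: "p \<in> ?P"
        let ?R = "{r \<in> roots_mod f p. int p dvd poly (u - v) r}"
        have "int p ^ card ?R dvd n"
          using p by (intro ndvd) (auto simp: roots_mod_def)
        then have "int (p ^ card ?R) dvd int m" by (simp add: m_def)
        then have "p ^ card ?R dvd m" by (simp only: of_nat_dvd_iff)
        then have "card ?R \<le> multiplicity p m"
          using p m by (intro multiplicity_geI) auto
        then have "real (card ?R) * ln (real p) \<le> real (multiplicity p m) * ln (real p)"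
          using p by (intro mult_right_mono) (auto dest: prime_ge_1_nat)
        then show "(\<Sum>r\<in>roots_mod f p. if int p dvd poly (u - v) r then ln (real p) else 0)
           \<le> real (multiplicity p m) * ln (real p)"
          by (simp add: sum.inter_filter[symmetric])
      qed
      also have "\<dots> \<le> ln (real m)"
        using m by (intro sum_multiplicity_ln_le) (auto simp: finite_primes_le)
      also have "\<dots> \<le> ln (real_of_int K * (2 ^ d * real x))"
      proof (subst ln_le_cancel_iff)
        have "real m = real_of_int \<bar>n\<bar>" by (simp add: m_def)
        also have "\<dots> \<le> real_of_int (K * int H ^ d)" using n(2) by (simp only: of_int_le_iff)
        also have "\<dots> = real_of_int K * b" by (simp add: b_def B(2))
        also have "\<dots> \<le> real_of_int K * (2 ^ d * real x)" using K b by (intro mult_left_mono) auto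
        finally show "real m \<le> \<dots>" .
      qed (use m K x in auto)
      also have "\<dots> = L" using K x by (simp add: L_def ln_mult ln_realpow)
      finally show ?thesis .
    qed
    define s where "s = (\<Sum>p\<in>?P. real (card (roots_mod f p)) * ln (real p) / real p)"
    \<comment> \<open>The total of \<open>pair\<close> over \<open>T\<close> is bounded below by
      counting, for each \<open>p\<close> and \<open>r\<close>, the pairs that agree at
      \<open>r\<close>. The term linear in \<open>b\<close> is the loss from the diagonal.\<close>
    have "b ^ 2 * s - b * (d * (\<Sum>p\<in>?P. ln (real p)))
      \<le> b ^ 2 * s - b * (\<Sum>p\<in>?P. real (card (roots_mod f p)) * ln (real p))"
    proof -
      have "(\<Sum>p\<in>?P. real (card (roots_mod f p)) * ln (real p)) \<le> (\<Sum>p\<in>?P. real d * ln (real p))"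
        using card_roots_mod_le[OF _ monic] 
        by (intro sum_mono mult_right_mono) (auto simp: d_def dest: prime_ge_1_nat)
      then show ?thesis using b by (simp add: sum_distrib_left[symmetric])
    qed
    also have "\<dots> = (\<Sum>p\<in>?P. \<Sum>r\<in>roots_mod f p. ln (real p) * (b ^ 2 / real p - b))"
      by (simp add: s_def sum_distrib_left sum_subtractf[symmetric] algebra_simps)
    also have "\<dots> \<le> (\<Sum>p\<in>?P. \<Sum>r\<in>roots_mod f p. ln (real p) * real (card {(u, v). (u, v) \<in> T \<and> int p dvd poly (u - v) r}))"
    proof (intro sum_mono mult_left_mono)
      fix p r assume "p \<in> ?P"
      then have "p > 0" by (auto dest: prime_gt_0_nat)
      from card_box_collisions_ge[OF B(1) this, of r]
      show "b ^ 2 / real p - b \<le> real (card {(u, v). (u, v) \<in> T \<and> int p dvd poly (u - v) r})"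
        by (simp add: b_def T_def conj_assoc)
    qed (auto dest: prime_ge_1_nat)
    also have "\<dots> = (\<Sum>p\<in>?P. \<Sum>r\<in>roots_mod f p. \<Sum>(u, v)\<in>T. if int p dvd poly (u - v) r then ln (real p) else 0)"
    proof (intro sum.cong refl)
      fix p r
      have "{(u, v). (u, v) \<in> T \<and> int p dvd poly (u - v) r} = {w \<in> T. int p dvd poly (fst w - snd w) r}" by auto
      then show "ln (real p) * real (card {(u, v). (u, v) \<in> T \<and> int p dvd poly (u - v) r})
        = (\<Sum>(u, v)\<in>T. if int p dvd poly (u - v) r then ln (real p) else 0)"
        using finT by (simp add: case_prod_unfold sum.inter_filter[symmetric])
    qed
    also have "\<dots> = (\<Sum>p\<in>?P. \<Sum>(u, v)\<in>T. \<Sum>r\<in>roots_mod f p. if int p dvd poly (u - v) r then ln (real p) else 0)"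
      unfolding case_prod_unfold by (intro sum.cong refl sum.swap)
    also have "\<dots> = (\<Sum>(u, v)\<in>T. \<Sum>p\<in>?P. \<Sum>r\<in>roots_mod f p. if int p dvd poly (u - v) r then ln (real p) else 0)"
      unfolding case_prod_unfold by (rule sum.swap)
    also have "\<dots> \<le> (\<Sum>(u, v)\<in>T. L)"
      using pair by (intro sum_mono) auto
    also have "\<dots> \<le> b ^ 2 * L" using cardT \<open>L \<ge> 0\<close> by (simp add: mult_right_mono)
    finally have main: "b ^ 2 * s - b * (d * (\<Sum>p\<in>?P. ln (real p))) \<le> b ^ 2 * L" .
    \<comment> \<open>By Chebyshev and \<open>x \<le> b\<close> the diagonal loss is also of order
      \<open>b ^ 2\<close>, so division by \<open>b ^ 2\<close> leaves a constant.\<close>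
    have "(\<Sum>p\<in>?P. ln (real p)) \<le> b * ln 4"
      using sum_ln_primes_le[of x] b(2) by (meson ln_ge_zero mult_right_mono one_le_numeral order.trans)
    then have "b * (d * (\<Sum>p\<in>?P. ln (real p))) \<le> b * (d * (b * ln 4))"
      using b(1) by (intro mult_left_mono) auto
    then have "b ^ 2 * s \<le> b ^ 2 * (L + d * ln 4)"
      using main by (simp add: algebra_simps power2_eq_square)
    then have "s \<le> L + d * ln 4" using b(1) by simp
    then show ?thesis by (simp add: s_def L_def)
  qed
  then show ?thesis by blast
qed

section \<open>Prime powers dividing polynomial values\<close>

text \<open>\<open>D\<close> plays the role of the discriminant of \<open>f\<close>.\<close>

lemma discriminant_multiple:
  fixes f :: "int poly"
  assumes monic: "lead_coeff f = 1" and irr: "irreducible f" and deg: "degree f \<noteq> 0"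
  obtains D u w where "D \<noteq> 0" "[:D:] = u * f + w * pderiv f"
proof -
  define H where "H = (\<Sum>i\<le>degree (pderiv f). \<bar>coeff (pderiv f) i\<bar>)"
  have H: "\<bar>coeff (pderiv f) i\<bar> \<le> H" for i
  proof (cases "i \<le> degree (pderiv f)")
    case True
    then show ?thesis unfolding H_def by (intro member_le_sum) auto
  next
    case False
    then show ?thesis by (simp add: coeff_eq_0 H_def sum_nonneg)
  qed
  have "pderiv f \<noteq> 0" "degree (pderiv f) < degree f"
    using deg by (auto simp: pderiv_eq_0_iff degree_pderiv)
  with H obtain D w where "D \<noteq> 0" "f dvd [:D:] - w * pderiv f"
    using norm_form[OF assms] by metis
  then obtain u where "[:D:] - w * pderiv f = f * u" by (auto elim: dvdE)
  then have "[:D:] = u * f + w * pderiv f" by (simp add: algebra_simps)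
  then show ?thesis using that \<open>D \<noteq> 0\<close> by blast
qed

text \<open>Two synthetic divisions at \<open>n\<close>, which avoid the denominator 2 of the Taylor
  formula.\<close>

lemma poly_taylor2:
  fixes f :: "'a :: idom poly"
  shows "\<exists>g. poly f m - poly f n = (m - n) * (poly (pderiv f) n + (m - n) * g)"
proof -
  define q where "q = synthetic_div f n"
  define s where "s = synthetic_div q n"
  have f: "f = [:-n, 1:] * q + [:poly f n:]"
    using synthetic_div_correct'[of n f] by (simp add: q_def)
  have q: "q = [:-n, 1:] * s + [:poly q n:]"
    using synthetic_div_correct'[of n q] by (simp add: s_def)
  have "poly (pderiv f) n = poly q n"
    by (subst f, unfold pderiv_add pderiv_mult) (simp add: pderiv_pCons)
  moreover have "poly f m = (m - n) * poly q m + poly f n"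
    by (subst f) (simp add: algebra_simps)
  moreover have "poly q m = (m - n) * poly s m + poly q n"
    by (subst q) (simp add: algebra_simps)
  ultimately show ?thesis by (intro exI[of _ "poly s m"]) (simp add: algebra_simps)
qed

text \<open>A Hensel-type argument with \<open>e = multiplicity p D\<close>. Write
  \<open>f(m) - f(n) = (m - n) * h\<close> with \<open>h\<close> congruent to \<open>f'(n)\<close>
  modulo \<open>p ^ (e + 1)\<close>. If \<open>p ^ (e + 1)\<close> divided \<open>h\<close>, it
  would divide \<open>f(n)\<close> and \<open>f'(n)\<close>, hence \<open>D\<close>. So
  \<open>h\<close> absorbs at most \<open>e\<close> of the \<open>k\<close> factors
  \<open>p\<close>.\<close>

lemma roots_mod_prime_power_close:
  fixes f :: "int poly" and p m n D :: int
  assumes D: "[:D:] = u * f + w * pderiv f" "D \<noteq> 0" and p: "prime p"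
    and k: "k > multiplicity p D"
    and dvd: "p ^ k dvd poly f m" "p ^ k dvd poly f n"
    and mn: "p ^ Suc (multiplicity p D) dvd m - n"
  shows "p ^ (k - multiplicity p D) dvd m - n"
proof (cases "m = n")
  case False
  define e where "e = multiplicity p D"
  obtain g where g: "poly f m - poly f n = (m - n) * (poly (pderiv f) n + (m - n) * g)"
    using poly_taylor2 by blast
  define h where "h = poly (pderiv f) n + (m - n) * g"
  have "\<not> is_unit p" using p not_prime_unit by blast
  have "\<not> p ^ Suc e dvd h"
  proof
    assume "p ^ Suc e dvd h"
    then have "p ^ Suc e dvd poly (pderiv f) n"
      using mn by (simp add: h_def e_def dvd_add_left_iff)
    moreover have "p ^ Suc e dvd poly f n"
      using dvd(2) k dvd_trans[OF le_imp_power_dvd[of "Suc e" k p]] by (simp add: e_def)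
    moreover have "D = poly u n * poly f n + poly w n * poly (pderiv f) n"
      using arg_cong[OF D(1), of "\<lambda>q. poly q n"] by simp
    ultimately have "p ^ Suc e dvd D" by simp
    then show False using D(2) \<open>\<not> is_unit p\<close> by (simp add: power_dvd_iff_le_multiplicity e_def del: power_Suc)
  qed
  then have "h \<noteq> 0" and h: "multiplicity p h \<le> e"
    using multiplicity_dvd'[of "Suc e" p h] by (auto simp del: power_Suc simp: not_less_eq_eq[symmetric])
  have "p ^ k dvd (m - n) * h" using dvd unfolding g[folded h_def, symmetric] by simp
  then have "k \<le> multiplicity p ((m - n) * h)"
    using \<open>\<not> is_unit p\<close> \<open>h \<noteq> 0\<close> False by (simp add: power_dvd_iff_le_multiplicity)
  also have "\<dots> = multiplicity p (m - n) + multiplicity p h"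
    using p \<open>h \<noteq> 0\<close> False by (intro prime_elem_multiplicity_mult_distrib) auto
  finally show ?thesis
    using h unfolding e_def[symmetric] by (intro multiplicity_dvd') linarith
qed simp

text \<open>Within one residue class modulo \<open>q\<close>, the quotient \<open>n div q\<close>
  determines \<open>n\<close>.\<close>

lemma card_congruent_le:
  assumes "S \<subseteq> {1..N}" "q > 0" "\<And>m n. m \<in> S \<Longrightarrow> n \<in> S \<Longrightarrow> int q dvd int m - int n"
  shows "real (card S) \<le> real N / real q + 1"
proof -
  have "inj_on (\<lambda>n. n div q) S"
  proof (rule inj_onI)
    fix m n assume mn: "m \<in> S" "n \<in> S" "m div q = n div q"
    have "int m mod int q = int n mod int q" using assms(3)[OF mn(1,2)] by (simp add: mod_eq_dvd_iff)
    then have "m mod q = n mod q" by (simp flip: zmod_int)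
    then show "m = n" using mn(3) by (metis div_mult_mod_eq)
  qed
  moreover have "(\<lambda>n. n div q) ` S \<subseteq> {0..N div q}" using assms(1) by (auto intro!: div_le_mono)
  ultimately have "card S \<le> card {0..N div q}" by (intro card_inj_on_le) auto
  then have "real (card S) \<le> real (N div q) + 1" by simp
  also have "real (N div q) \<le> real N / real q" by (rule of_nat_div_le_of_nat)
  finally show ?thesis by simp
qed

text \<open>Sort the solutions by their residue modulo \<open>p ^ (e + 1)\<close>, which lies in
  \<open>R\<close>; those sharing a residue agree even modulo \<open>p ^ (k - e)\<close>. Any finite
  superset of the roots may serve as \<open>R\<close>, which suits both cases treated later.\<close>

lemma card_prime_power_dvd_le:
  fixes f :: "int poly" and D :: int
  assumes D: "[:D:] = u * f + w * pderiv f" "D \<noteq> 0" and p: "prime p"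
    and e: "e = multiplicity (int p) D" and k: "k > e"
    and R: "finite R" "\<And>r. 0 \<le> r \<Longrightarrow> r < int p ^ Suc e \<Longrightarrow> int p ^ Suc e dvd poly f r \<Longrightarrow> r \<in> R"
  shows "real (card {n \<in> {1..N}. int p ^ k dvd poly f (int n)}) \<le> real (card R) * (real N / real p ^ (k - e) + 1)"
proof -
  let ?S = "{n \<in> {1..N}. int p ^ k dvd poly f (int n)}"
  let ?g = "\<lambda>n. int n mod int p ^ Suc e"
  have p0: "p > 0" using p by (simp add: prime_gt_0_nat)
  have sub: "?g n \<in> R" if "n \<in> ?S" for n
  proof (rule R(2))
    have "int p ^ Suc e dvd poly f (int n)"
      using that k dvd_trans[OF le_imp_power_dvd[of "Suc e" k "int p"]] by simp
    moreover obtain g where "poly f (?g n) - poly f (int n) = (?g n - int n) * g"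
      using poly_taylor2 by blast
    moreover have "int p ^ Suc e dvd ?g n - int n" by (simp add: mod_eq_dvd_iff flip: mod_eq_dvd_iff)
    ultimately have "int p ^ Suc e dvd (poly f (?g n) - poly f (int n)) + poly f (int n)"
      by (intro dvd_add) auto
    then show "int p ^ Suc e dvd poly f (?g n)" by simp
  qed (use p0 in auto)
  have fiber: "real (card {n \<in> ?S. ?g n = r}) \<le> real N / real (p ^ (k - e)) + 1" for r
  proof (rule card_congruent_le)
    fix m n assume mn: "m \<in> {n \<in> ?S. ?g n = r}" "n \<in> {n \<in> ?S. ?g n = r}"
    then have "?g m = ?g n" by simp
    then have "int p ^ Suc e dvd int m - int n" unfolding mod_eq_dvd_iff .
    then show "int (p ^ (k - e)) dvd int m - int n"
      using roots_mod_prime_power_close[OF D, of "int p" k "int m" "int n"] mn p k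
      by (simp add: e)
  qed (use p0 in auto)
  have "?S = (\<Union>r\<in>R. {n \<in> ?S. ?g n = r})" using sub by blast
  from arg_cong[OF this, of card] card_UN_le[OF R(1), of "\<lambda>r. {n \<in> ?S. ?g n = r}"]
  have "card ?S \<le> (\<Sum>r\<in>R. card {n \<in> ?S. ?g n = r})" by linarith
  then have "real (card ?S) \<le> (\<Sum>r\<in>R. real (card {n \<in> ?S. ?g n = r}))"
    unfolding of_nat_sum[symmetric] of_nat_le_iff .
  also have "\<dots> \<le> (\<Sum>r\<in>R. real N / real (p ^ (k - e)) + 1)" by (intro sum_mono fiber)
  finally show ?thesis by simp
qed

lemma sum_multiplicity_eq_sum_card:
  fixes F :: "nat \<Rightarrow> 'a :: factorial_semiring"
  assumes "finite S" "\<And>n. n \<in> S \<Longrightarrow> F n \<noteq> 0" "\<And>n. n \<in> S \<Longrightarrow> multiplicity p (F n) \<le> K" "\<not> is_unit p"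
  shows "(\<Sum>n\<in>S. multiplicity p (F n)) = (\<Sum>k=1..K. card {n \<in> S. p ^ k dvd F n})"
proof -
  have "(\<Sum>n\<in>S. multiplicity p (F n)) = (\<Sum>n\<in>S. \<Sum>k=1..K. if p ^ k dvd F n then 1 else 0)"
  proof (rule sum.cong[OF refl])
    fix n assume n: "n \<in> S"
    have "{k \<in> {1..K}. p ^ k dvd F n} = {1..multiplicity p (F n)}"
      using assms(2,3)[OF n] assms(4) by (auto simp: power_dvd_iff_le_multiplicity)
    then show "multiplicity p (F n) = (\<Sum>k=1..K. if p ^ k dvd F n then 1 else 0)"
      by (simp add: sum.inter_filter[symmetric])
  qed
  also have "\<dots> = (\<Sum>k=1..K. \<Sum>n\<in>S. if p ^ k dvd F n then 1 else 0)" by (rule sum.swap)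
  also have "\<dots> = (\<Sum>k=1..K. card {n \<in> S. p ^ k dvd F n})"
    using assms(1) by (simp add: sum.inter_filter[symmetric])
  finally show ?thesis .
qed

lemma sum_inverse_powers_le:
  assumes "p \<ge> (2::real)"
  shows "(\<Sum>k=1..K. 1 / p ^ k) \<le> 1 / (p - 1)"
proof -
  have "(\<Sum>k=1..K. 1 / p ^ k) = (1 - 1 / p ^ K) / (p - 1)"
  proof (induction K)
    case (Suc K)
    have "(\<Sum>k=1..Suc K. 1 / p ^ k) = (1 - 1 / p ^ K) / (p - 1) + 1 / p ^ Suc K" using Suc by simp
    also have "\<dots> = (1 - 1 / p ^ Suc K) / (p - 1)" using assms by (simp add: field_simps)
    finally show ?case .
  qed simp
  also have "\<dots> \<le> 1 / (p - 1)" using assms by (intro divide_right_mono) auto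
  finally show ?thesis .
qed

section \<open>The exponent of a single prime in the product of the values\<close>

definition abs_value :: "int poly \<Rightarrow> nat \<Rightarrow> nat" where
  "abs_value f n = nat \<bar>poly f (int n)\<bar>"

lemma dvd_abs_value_iff: "m dvd abs_value f n \<longleftrightarrow> int m dvd poly f (int n)"
proof -
  have "m dvd abs_value f n \<longleftrightarrow> int m dvd int (abs_value f n)" by (simp only: of_nat_dvd_iff)
  then show ?thesis by (simp add: abs_value_def)
qed

lemma multiplicity_ln_le:
  assumes "prime p" "m > 0"
  shows "real (multiplicity p m) * ln (real p) \<le> ln (real m)"
  using sum_multiplicity_ln_le(1)[of m "{p}"] assms by simp

text \<open>Count the \<open>n\<close> with \<open>p ^ k dvd f(n)\<close> for every
  \<open>k\<close>. Levels \<open>k \<le> e\<close> cost at most \<open>N\<close> each; above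
  \<open>e\<close>, the parts \<open>N / p ^ (k - e)\<close> form a geometric series, and the
  \<open>+ 1\<close> parts add up to \<open>K\<close> per residue, where
  \<open>K * ln p \<le> \<Lambda>\<close>.\<close>

lemma sum_multiplicity_abs_value_le:
  fixes f :: "int poly" and D :: int
  assumes D: "[:D:] = u * f + w * pderiv f" "D \<noteq> 0" and p: "prime p"
    and e: "e = multiplicity (int p) D"
    and R: "finite R" "\<And>r. 0 \<le> r \<Longrightarrow> r < int p ^ Suc e \<Longrightarrow> int p ^ Suc e dvd poly f r \<Longrightarrow> r \<in> R"
    and nz: "\<And>n. n \<in> {1..N} \<Longrightarrow> abs_value f n > 0"
    and \<Lambda>: "\<And>n. n \<in> {1..N} \<Longrightarrow> ln (real (abs_value f n)) \<le> \<Lambda>" and N: "N \<ge> 1"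
  shows "real (\<Sum>n=1..N. multiplicity p (abs_value f n)) * ln (real p)
    \<le> real e * real N * ln (real p) + real (card R) * real N * ln (real p) / (real p - 1) + real (card R) * \<Lambda>"
proof -
  define K where "K = Max ((\<lambda>n. multiplicity p (abs_value f n)) ` {1..N})"
  have p2: "p \<ge> 2" using p by (rule prime_ge_2_nat)
  have "K \<in> (\<lambda>n. multiplicity p (abs_value f n)) ` {1..N}"
    unfolding K_def using N by (intro Max_in) auto
  then obtain n where n: "n \<in> {1..N}" "K = multiplicity p (abs_value f n)" by blast
  then have K\<Lambda>: "real K * ln (real p) \<le> \<Lambda>"
    using multiplicity_ln_le[OF p nz[OF n(1)]] \<Lambda>[OF n(1)] by simp
  have K: "multiplicity p (abs_value f n) \<le> K" if "n \<in> {1..N}" for n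
    unfolding K_def using that by (intro Max_ge) auto
  define c where "c k = card {n \<in> {1..N}. p ^ k dvd abs_value f n}" for k
  \<comment> \<open>Counting up to \<open>e + K\<close> instead of \<open>K\<close> adds only zeros
    and lets the sum split at \<open>e\<close>.\<close>
  have "(\<Sum>n=1..N. multiplicity p (abs_value f n)) = (\<Sum>k=1..e + K. c k)"
    unfolding c_def using nz K p2 by (intro sum_multiplicity_eq_sum_card) (auto intro: trans_le_add2)
  also have "\<dots> = (\<Sum>k=1..e. c k) + (\<Sum>k=1..K. c (k + e))"
    using sum.ub_add_nat[of 1 e c K] sum.shift_bounds_cl_nat_ivl[of c 1 e K] by (simp add: add.commute)
  finally have "real (\<Sum>n=1..N. multiplicity p (abs_value f n)) = (\<Sum>k=1..e. real (c k)) + (\<Sum>k=1..K. real (c (k + e)))"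
    by simp
  also have "(\<Sum>k=1..e. real (c k)) \<le> (\<Sum>k=1..e. real N)"
  proof (intro sum_mono)
    fix k
    have "c k \<le> card {1..N}" unfolding c_def by (intro card_mono) auto
    then show "real (c k) \<le> real N" by simp
  qed
  also have "(\<Sum>k=1..K. real (c (k + e))) \<le> (\<Sum>k=1..K. real (card R) * (real N * (1 / real p ^ k) + 1))"
  proof (intro sum_mono)
    fix k assume "k \<in> {1..K}"
    then show "real (c (k + e)) \<le> real (card R) * (real N * (1 / real p ^ k) + 1)"
      using card_prime_power_dvd_le[OF D p e, of "k + e" R N] R
      by (simp add: c_def dvd_abs_value_iff)
  qed
  also have "\<dots> = real (card R) * (real N * (\<Sum>k=1..K. 1 / real p ^ k) + real K)"
    by (simp add: sum.distrib distrib_left sum_distrib_left mult.assoc)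
  also have "\<dots> \<le> real (card R) * (real N * (1 / (real p - 1)) + real K)"
    using p2 by (intro mult_left_mono add_right_mono sum_inverse_powers_le) auto
  finally have "real (\<Sum>n=1..N. multiplicity p (abs_value f n)) * ln (real p)
    \<le> ((\<Sum>k=1..e. real N) + real (card R) * (real N * (1 / (real p - 1)) + real K)) * ln (real p)"
    using p2 by (intro mult_right_mono) auto
  also have "\<dots> = real e * real N * ln (real p) + real (card R) * real N * ln (real p) / (real p - 1)
     + real (card R) * (real K * ln (real p))"
    by (simp add: algebra_simps)
  also have "real (card R) * (real K * ln (real p)) \<le> real (card R) * \<Lambda>"
    using K\<Lambda> by (intro mult_left_mono) auto
  finally show ?thesis by simp
qed

section \<open>Large primes and the evenness of the polynomial\<close>

lemma even_poly_minus:
  assumes "even_poly f"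
  shows "poly f (- x) = poly f x"
proof -
  have "poly f (- x) = poly (pcompose f [:0, -1:]) x" by (simp add: poly_pcompose)
  then show ?thesis using assms by (simp add: even_poly_def)
qed

text \<open>For \<open>p > 2 N\<close> the residues of \<open>\<plusminus>1, \<dots>, \<plusminus>N\<close> are distinct, so that every \<open>n\<close> with
  \<open>p dvd f(n)\<close> uses up two roots of \<open>f\<close> modulo \<open>p\<close>.\<close>

lemma sum_multiplicity_even_poly_le:
  assumes "lead_coeff f = 1" "even_poly f" and p: "prime p" "p > 2 * N"
    and nz: "\<And>n. n \<in> {1..N} \<Longrightarrow> abs_value f n > 0"
    and L: "L > 0" "\<And>n. n \<in> {1..N} \<Longrightarrow> abs_value f n dvd L"
  shows "2 * (\<Sum>n=1..N. multiplicity p (abs_value f n)) \<le> degree f * multiplicity p L"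
proof -
  define S where "S = {n \<in> {1..N}. p dvd abs_value f n}"
  define R where "R = int ` S \<union> (\<lambda>n. - int n) ` S"
  have "finite S" by (simp add: S_def)
  have "card R = card (int ` S) + card ((\<lambda>n. - int n) ` S)"
    unfolding R_def using \<open>finite S\<close> by (intro card_Un_disjoint) (auto simp: S_def)
  also have "\<dots> = 2 * card S" by (subst (1 2) card_image) (auto simp: inj_on_def)
  finally have "2 * card S = card R" by simp
  also have "\<dots> \<le> degree f"
  proof (rule card_roots_mod_prime_le[of "int p"])
    fix r s assume rs: "r \<in> R" "s \<in> R" "int p dvd r - s"
    then have "\<bar>r - s\<bar> < int p" using p(2) by (auto simp: R_def S_def)
    with rs(3) show "r = s" using dvd_imp_le_int[of "r - s" "int p"] by fastforce
  qed (use assms \<open>finite S\<close> in \<open>auto simp: R_def S_def dvd_abs_value_iff even_poly_minus\<close>)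
  finally have card: "2 * card S \<le> degree f" .
  have "(\<Sum>n=1..N. multiplicity p (abs_value f n)) = (\<Sum>n\<in>S. multiplicity p (abs_value f n))"
    by (intro sum.mono_neutral_right) (auto simp: S_def not_dvd_imp_multiplicity_0)
  also have "\<dots> \<le> (\<Sum>n\<in>S. multiplicity p L)"
    using L by (intro sum_mono dvd_imp_multiplicity_le) (auto simp: S_def)
  finally have "2 * (\<Sum>n=1..N. multiplicity p (abs_value f n)) \<le> 2 * card S * multiplicity p L" by simp
  also have "\<dots> \<le> degree f * multiplicity p L" using card by (rule mult_right_mono) simp
  finally show ?thesis .
qed

section \<open>Growth estimates\<close>

lemma irreducible_no_root:
  fixes f :: "'a :: idom poly"
  assumes "irreducible f" "degree f \<ge> 2"
  shows "poly f x \<noteq> 0"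
proof
  assume "poly f x = 0"
  then obtain q where q: "f = [:-x, 1:] * q" by (auto simp: poly_eq_0_iff_dvd elim: dvdE)
  then have "q \<noteq> 0" using assms(2) by auto
  then have "degree f = Suc (degree q)" unfolding q by (subst degree_mult_eq) auto
  then show False
    using irreducibleD[OF assms(1) q] assms(2) by (auto simp: is_unit_poly_iff)
qed

text \<open>The lower-order part, multiplied by \<open>n\<close>, is at most
  \<open>B * n ^ d\<close>; once \<open>n \<ge> 2 * (B + 1)\<close> it is at most half the leading
  term.\<close>

lemma monic_poly_growth:
  fixes f :: "int poly"
  assumes monic: "lead_coeff f = 1" and deg: "degree f \<noteq> 0"
  obtains A :: int where "A > 0"
    "\<And>n. n \<ge> 1 \<Longrightarrow> \<bar>poly f n\<bar> \<le> A * n ^ degree f"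
    "\<And>n. n \<ge> 2 * A \<Longrightarrow> n ^ degree f \<le> 2 * \<bar>poly f n\<bar>"
proof -
  define d where "d = degree f"
  define B where "B = (\<Sum>i<d. \<bar>coeff f i\<bar>)"
  have "B \<ge> 0" by (auto simp: B_def intro: sum_nonneg)
  have eq: "poly f n = n ^ d + (\<Sum>i<d. coeff f i * n ^ i)" for n
    using monic by (simp add: poly_altdef d_def lessThan_Suc_atMost[symmetric])
  have rest: "\<bar>\<Sum>i<d. coeff f i * n ^ i\<bar> * n \<le> B * n ^ d" if "n \<ge> 1" for n
  proof -
    have "\<bar>\<Sum>i<d. coeff f i * n ^ i\<bar> \<le> (\<Sum>i<d. \<bar>coeff f i * n ^ i\<bar>)" by (rule sum_abs)
    also have "\<dots> \<le> (\<Sum>i<d. \<bar>coeff f i\<bar> * n ^ (d - 1))"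
      using that by (intro sum_mono) (auto simp: abs_mult intro!: mult_left_mono power_increasing)
    also have "\<dots> = B * n ^ (d - 1)" by (simp add: B_def sum_distrib_right)
    finally have "\<bar>\<Sum>i<d. coeff f i * n ^ i\<bar> * n \<le> B * n ^ (d - 1) * n"
      using that by (intro mult_right_mono) auto
    also have "\<dots> = B * n ^ d" using deg power_minus_mult[of d n] by (simp add: d_def mult.assoc)
    finally show ?thesis .
  qed
  show ?thesis
  proof (rule that[of "B + 1"])
    fix n :: int assume n: "n \<ge> 1"
    have "\<bar>\<Sum>i<d. coeff f i * n ^ i\<bar> * 1 \<le> \<bar>\<Sum>i<d. coeff f i * n ^ i\<bar> * n"
      using n by (intro mult_left_mono) auto
    also note rest[OF n]
    finally show "\<bar>poly f n\<bar> \<le> (B + 1) * n ^ degree f"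
      unfolding eq d_def[symmetric] using n abs_triangle_ineq[of "n ^ d" "\<Sum>i<d. coeff f i * n ^ i"]
      by (simp add: distrib_right)
  next
    fix n :: int assume n: "n \<ge> 2 * (B + 1)"
    let ?s = "\<Sum>i<d. coeff f i * n ^ i"
    have "n \<ge> 1" using n \<open>B \<ge> 0\<close> by presburger
    have "(2 * \<bar>?s\<bar>) * n \<le> (2 * B) * n ^ d" using rest[OF \<open>n \<ge> 1\<close>] by simp
    also have "\<dots> \<le> n * n ^ d" using n by (intro mult_right_mono) (use \<open>n \<ge> 1\<close> in auto)
    finally have "2 * \<bar>?s\<bar> \<le> n ^ d" using \<open>n \<ge> 1\<close> by (simp add: mult.commute)
    moreover have "x \<le> 2 * \<bar>x + s\<bar>" if "2 * \<bar>s\<bar> \<le> x" for x s :: int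
      using that by arith
    ultimately show "n ^ degree f \<le> 2 * \<bar>poly f n\<bar>" unfolding eq d_def[symmetric] by blast
  qed (use \<open>B \<ge> 0\<close> in simp)
qed

text \<open>The induction step amounts to \<open>N * ln (1 + 1 / N) \<le> 1\<close>.\<close>

lemma sum_ln_ge: "real N * ln (real N) - real N \<le> (\<Sum>n=1..N. ln (real n))"
proof (induction N)
  case (Suc N)
  show ?case
  proof (cases "N = 0")
    case False
    have "1 + 1 / real N = real (Suc N) / real N" using False by (simp add: field_simps)
    then have "ln (real (Suc N)) - ln (real N) = ln (1 + 1 / real N)"
      using False by (simp add: ln_div)
    also have "\<dots> \<le> 1 / real N" by (intro ln_add_one_self_le_self) auto
    finally have "real N * (ln (real (Suc N)) - ln (real N)) \<le> 1"
      using False by (simp add: field_simps)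
    then show ?thesis using Suc by (simp add: algebra_simps)
  qed simp
qed simp

text \<open>Comparison with a convergent series, using \<open>ln p \<le> 2 * sqrt p\<close>.\<close>

lemma sum_ln_prime_over_square_bounded:
  "\<exists>S. \<forall>x. (\<Sum>p | prime p \<and> p \<le> x. ln (real p) / real p ^ 2) \<le> S"
proof -
  have s: "summable (\<lambda>n. 2 * real n powr (-3/2))"
    by (intro summable_mult) (simp add: summable_real_powr_iff)
  have "(\<Sum>p | prime p \<and> p \<le> x. ln (real p) / real p ^ 2) \<le> (\<Sum>n. 2 * real n powr (-3/2))" for x
  proof -
    have "ln (real p) / real p ^ 2 \<le> 2 * real p powr (-3/2)" if "prime p" for p
    proof -
      have p: "real p > 0" using that by (simp add: prime_gt_0_nat)
      have "ln (real p) = 2 * ln (sqrt p)" using p by (simp add: ln_sqrt)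
      also have "ln (sqrt p) \<le> sqrt p - 1" using p by (intro ln_le_minus_one) auto
      finally have "ln (real p) \<le> 2 * real p powr (1/2)" using p by (simp add: powr_half_sqrt)
      then have "ln (real p) / real p ^ 2 \<le> 2 * real p powr (1/2) / real p powr 2"
        using p by (simp add: divide_right_mono)
      also have "\<dots> = 2 * real p powr (-3/2)" using powr_diff[of "real p" "1/2" 2] by (simp del: powr_numeral)
      finally show ?thesis .
    qed
    then have "(\<Sum>p | prime p \<and> p \<le> x. ln (real p) / real p ^ 2) \<le> (\<Sum>p | prime p \<and> p \<le> x. 2 * real p powr (-3/2))"
      by (intro sum_mono) auto
    also have "\<dots> \<le> (\<Sum>n. 2 * real n powr (-3/2))"
      using s by (intro sum_le_suminf) (auto simp: finite_primes_le)
    finally show ?thesis .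
  qed
  then show ?thesis by blast
qed

section \<open>Lower bound for the least common multiple\<close>

lemma sum_multiplicity_abs_value_bound:
  fixes f :: "int poly" and A \<Lambda> :: real
  assumes D: "[:D:] = u * f + w * pderiv f" "D \<noteq> 0" and monic: "lead_coeff f = 1" and p: "prime p"
    and nz: "\<And>n. n \<in> {1..N} \<Longrightarrow> abs_value f n > 0"
    and \<Lambda>: "\<And>n. n \<in> {1..N} \<Longrightarrow> ln (real (abs_value f n)) \<le> \<Lambda>" "0 \<le> \<Lambda>" "\<Lambda> \<le> A * real N" and N: "N \<ge> 1"
  defines "q \<equiv> real p ^ Suc (multiplicity (int p) D)"
  shows "real (\<Sum>n=1..N. multiplicity p (abs_value f n)) * ln (real p)
    \<le> real N * (real (card (roots_mod f p)) * ln (real p) / real p) + 2 * degree f * real N * (ln (real p) / real p ^ 2)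
      + degree f * \<Lambda>
      + (if int p dvd D then real N * (real (multiplicity (int p) D) * ln (real p) + q * ln (real p) + q * A) else 0)"
    (is "?\<alpha> \<le> ?M + ?B")
proof -
  have p2: "p \<ge> 2" using p by (rule prime_ge_2_nat)
  define e where "e = multiplicity (int p) D"
  note bound = sum_multiplicity_abs_value_le[OF D p e_def _ _ nz \<Lambda>(1) N]
  show ?thesis
  proof (cases "int p dvd D")
    case False
    then have e: "e = 0" by (simp add: e_def not_dvd_imp_multiplicity_0)
    let ?\<rho> = "real (card (roots_mod f p))"
    have "r \<in> roots_mod f p" if "0 \<le> r" "r < int p ^ Suc e" "int p ^ Suc e dvd poly f r" for r
      using that by (simp add: e roots_mod_def)
    from bound[OF finite_roots_mod this]
    have "?\<alpha> \<le> ?\<rho> * real N * ln (real p) / (real p - 1) + ?\<rho> * \<Lambda>"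
      by (simp add: e)
    also have "?\<rho> * real N * ln (real p) / (real p - 1) = (?\<rho> * real N * ln (real p)) * (1 / (real p - 1))" by simp
    also have "\<dots> \<le> (?\<rho> * real N * ln (real p)) * (1 / real p + 2 / real p ^ 2)"
    proof (rule mult_left_mono)
      \<comment> \<open>This separates the Mertens term from a summable remainder:
        \<open>1 / (x - 1) - 1 / x = 1 / (x * (x - 1))\<close>, and
        \<open>x - 1 \<ge> x / 2\<close>.\<close>
      have "1 / (x - 1) \<le> 1 / x + 2 / x ^ 2" if "x \<ge> 2" for x :: real
        using that by (simp add: field_simps power2_eq_square)
      then show "1 / (real p - 1) \<le> 1 / real p + 2 / real p ^ 2" using p2 by simp
    qed (use p2 in auto)
    also have "\<dots> = real N * (?\<rho> * ln (real p) / real p) + ?\<rho> * (2 * real N * (ln (real p) / real p ^ 2))"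
      by (simp add: algebra_simps)
    also have "?\<rho> * (2 * real N * (ln (real p) / real p ^ 2)) \<le> degree f * (2 * real N * (ln (real p) / real p ^ 2))"
      using card_roots_mod_le[OF p monic] p2 by (intro mult_right_mono) auto
    also have "?\<rho> * \<Lambda> \<le> degree f * \<Lambda>"
      using card_roots_mod_le[OF p monic] \<Lambda>(2) by (intro mult_right_mono) auto
    finally show ?thesis using False by (simp add: mult_ac)
  next
    case True
    let ?R = "{0..<int (p ^ Suc e)}"
    have cR: "real (card ?R) = q" by (simp add: q_def e_def)
    have "q \<ge> 0" by (simp add: q_def)
    have "?\<alpha> \<le> real e * real N * ln (real p) + q * real N * ln (real p) / (real p - 1) + q * \<Lambda>"
      using bound[of ?R] unfolding cR by simp
    also have "q * real N * ln (real p) / (real p - 1) \<le> q * real N * ln (real p)"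
      using p2 \<open>q \<ge> 0\<close> divide_left_mono[of 1 "real p - 1" "q * real N * ln (real p)"] by simp
    also have "q * \<Lambda> \<le> q * (A * real N)" using \<Lambda>(3) \<open>q \<ge> 0\<close> by (rule mult_left_mono)
    finally have "?\<alpha> \<le> ?B" using True by (simp add: e_def algebra_simps)
    moreover have "0 \<le> ?M" using p2 \<Lambda>(2) by (intro add_nonneg_nonneg mult_nonneg_nonneg) auto
    ultimately show ?thesis by linarith
  qed
qed

text \<open>Sum the bound for single primes: the first term gives \<open>N ln N\<close> by the
  Mertens-type bound, the second converges, the third is \<open>O(N)\<close> by Chebyshev, and the
  prime divisors of \<open>D\<close> add a constant times \<open>N\<close>.\<close>

lemma sum_small_primes_le:
  fixes f :: "int poly" and A :: real
  assumes monic: "lead_coeff f = 1" and irr: "irreducible f" and deg: "degree f \<ge> 2"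
    and A: "A \<ge> 0" "\<And>n. n \<ge> 1 \<Longrightarrow> ln (real (abs_value f n)) \<le> A + degree f * ln (real n)"
  shows "\<exists>C. \<forall>N\<ge>1. (\<Sum>p | prime p \<and> p \<le> 2 * N. real (\<Sum>n=1..N. multiplicity p (abs_value f n)) * ln (real p))
    \<le> real N * ln (real N) + C * real N"
proof -
  define d where "d = degree f"
  have deg0: "degree f \<noteq> 0" using deg by simp
  obtain D u w where D: "D \<noteq> 0" "[:D:] = u * f + w * pderiv f"
    using discriminant_multiple[OF monic irr deg0] .
  obtain C1 where C1: "\<And>x. x \<ge> 1 \<Longrightarrow> (\<Sum>p | prime p \<and> p \<le> x. real (card (roots_mod f p)) * ln (real p) / real p) \<le> ln (real x) + C1"
    using sum_roots_mod_ln_le[OF monic irr deg0] by metis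
  obtain S where S: "\<And>x. (\<Sum>p | prime p \<and> p \<le> x. ln (real p) / real p ^ 2) \<le> S"
    using sum_ln_prime_over_square_bounded by metis
  define c where "c p = real (multiplicity (int p) D) * ln (real p) + real p ^ Suc (multiplicity (int p) D) * ln (real p)
    + real p ^ Suc (multiplicity (int p) D) * (A + d)" for p
  have c: "c p \<ge> 0" if "prime p" for p
    using that A(1) unfolding c_def by (intro add_nonneg_nonneg mult_nonneg_nonneg) (auto dest: prime_ge_1_nat)
  define Bad where "Bad = {p. prime p \<and> p dvd nat \<bar>D\<bar>}"
  have finB: "finite Bad" unfolding Bad_def
    using D(1) by (intro finite_subset[OF _ finite_divisors_nat[of "nat \<bar>D\<bar>"]]) auto
  have nz: "abs_value f n > 0" for n
    using irreducible_no_root[OF irr deg] by (simp add: abs_value_def)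
  have "(\<Sum>p | prime p \<and> p \<le> 2 * N. real (\<Sum>n=1..N. multiplicity p (abs_value f n)) * ln (real p))
    \<le> real N * ln (real N) + (ln 2 + C1 + 2 * d * S + 2 * d * A + 12 * d\<^sup>2 + (\<Sum>p\<in>Bad. c p)) * real N" if N: "N \<ge> 1" for N
  proof -
    let ?P = "{p. prime p \<and> p \<le> 2 * N}"
    define \<Lambda> where "\<Lambda> = A + d * ln (real N)"
    have \<Lambda>: "ln (real (abs_value f n)) \<le> \<Lambda>" if n: "n \<in> {1..N}" for n
    proof -
      have "ln (real n) \<le> ln (real N)" using n by simp
      then have "d * ln (real n) \<le> d * ln (real N)" by (intro mult_left_mono) auto
      then show ?thesis using A(2)[of n] n by (simp add: \<Lambda>_def d_def)
    qed
    have "\<Lambda> \<ge> 0" using A(1) N by (simp add: \<Lambda>_def)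
    have "ln (real N) \<le> real N" using N ln_le_minus_one[of "real N"] by simp
    then have "d * ln (real N) \<le> d * real N" by (intro mult_left_mono) auto
    moreover have "A * 1 \<le> A * real N" using N A(1) by (intro mult_left_mono) auto
    ultimately have \<Lambda>_le: "\<Lambda> \<le> (A + d) * real N" by (simp add: \<Lambda>_def distrib_right)
    have "(\<Sum>p\<in>?P. real (\<Sum>n=1..N. multiplicity p (abs_value f n)) * ln (real p))
      \<le> (\<Sum>p\<in>?P. real N * (real (card (roots_mod f p)) * ln (real p) / real p) + 2 * d * real N * (ln (real p) / real p ^ 2)
      + d * \<Lambda> + (if int p dvd D then real N * c p else 0))"
      unfolding c_def d_def
      using nz \<Lambda> \<open>\<Lambda> \<ge> 0\<close> \<Lambda>_le[unfolded d_def] N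
      by (intro sum_mono sum_multiplicity_abs_value_bound[OF D(2,1) monic]) auto
    also have "\<dots> = real N * (\<Sum>p\<in>?P. real (card (roots_mod f p)) * ln (real p) / real p)
       + 2 * d * real N * (\<Sum>p\<in>?P. ln (real p) / real p ^ 2) + real (card ?P) * (d * \<Lambda>)
       + (\<Sum>p\<in>?P. if int p dvd D then real N * c p else 0)"
      by (simp add: sum.distrib sum_distrib_left)
    also have "real N * (\<Sum>p\<in>?P. real (card (roots_mod f p)) * ln (real p) / real p) \<le> real N * (ln (real (2 * N)) + C1)"
      using N by (intro mult_left_mono C1) auto
    also have "2 * d * real N * (\<Sum>p\<in>?P. ln (real p) / real p ^ 2) \<le> 2 * d * real N * S"
      by (intro mult_left_mono S) auto
    \<comment> \<open>The constant part \<open>A\<close> of \<Lambda> is paid for by the trivial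
      count \<open>2 * N\<close>, the logarithmic part by \<open>card_primes_le\<close> at
      \<open>2 * N\<close>, whence 12.\<close>
    also have "real (card ?P) * (d * \<Lambda>) \<le> d * (2 * A * real N + 12 * d * real N)"
    proof -
      have "card ?P \<le> card {1..2 * N}" by (intro card_mono) (auto dest: prime_ge_1_nat)
      then have "real (card ?P) \<le> 2 * real N" by simp
      then have "real (card ?P) * A \<le> 2 * real N * A" using A(1) by (rule mult_right_mono)
      moreover have "real (card ?P) * ln (real N) \<le> 12 * real N"
      proof -
        have "real (card ?P) * ln (real N) \<le> real (card ?P) * ln (real (2 * N))"
          using N by (intro mult_left_mono) auto
        also have "\<dots> \<le> 6 * real (2 * N)" using N by (intro card_primes_le) auto
        finally show ?thesis by simp
      qed
      then have "d * (real (card ?P) * ln (real N)) \<le> d * (12 * real N)" by (intro mult_left_mono) auto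
      ultimately have "real (card ?P) * \<Lambda> \<le> 2 * A * real N + 12 * d * real N"
        by (simp add: \<Lambda>_def algebra_simps)
      then have "d * (real (card ?P) * \<Lambda>) \<le> d * (2 * A * real N + 12 * d * real N)" by (intro mult_left_mono) auto
      then show ?thesis by (simp add: mult_ac)
    qed
    also have "(\<Sum>p\<in>?P. if int p dvd D then real N * c p else 0) \<le> real N * (\<Sum>p\<in>Bad. c p)"
    proof -
      have "(\<Sum>p\<in>?P. if int p dvd D then real N * c p else 0) = (\<Sum>p | p \<in> ?P \<and> int p dvd D. real N * c p)"
        by (intro sum.inter_filter[symmetric] finite_primes_le)
      also have "\<dots> \<le> (\<Sum>p\<in>Bad. real N * c p)"
        using finB c by (intro sum_mono2) (auto simp: Bad_def)
      finally show ?thesis by (simp add: sum_distrib_left)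
    qed
    finally show ?thesis using N by (simp add: ln_mult algebra_simps power2_eq_square)
  qed
  then show ?thesis by blast
qed

theorem theorem1p2:
  fixes f :: "int poly"
  assumes "lead_coeff f = 1"
    and "irreducible f"
    and "degree f \<ge> 2"
    and "even_poly f"
  shows "\<exists>C::real. C > 0 \<and> (\<forall>N::nat. N \<ge> 2 \<longrightarrow>
           ln (real_of_int (lcm_values f N)) \<ge>
             2 * (real (degree f) - 1) / real (degree f) * real N * ln (real N) - C * real N)"
proof -
  define d where "d = degree f"
  have d: "d \<ge> 2" using assms(3) by (simp add: d_def)
  then have deg0: "degree f \<noteq> 0" by (simp add: d_def)
  have nz: "abs_value f n > 0" for n
    using irreducible_no_root[OF assms(2,3)] by (simp add: abs_value_def)
  obtain A :: int where A: "A > 0"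
    "\<And>n. n \<ge> 1 \<Longrightarrow> \<bar>poly f n\<bar> \<le> A * n ^ d"
    "\<And>n. n \<ge> 2 * A \<Longrightarrow> n ^ d \<le> 2 * \<bar>poly f n\<bar>"
    using monic_poly_growth[OF assms(1) deg0] unfolding d_def by metis
  have upper: "ln (real (abs_value f n)) \<le> ln A + d * ln (real n)" if "n \<ge> 1" for n
  proof -
    have "real (abs_value f n) = real_of_int \<bar>poly f (int n)\<bar>" by (simp add: abs_value_def)
    also have "\<dots> \<le> real_of_int (A * int n ^ d)" using A(2)[of "int n"] that by (simp only: of_int_le_iff)
    finally have "ln (real (abs_value f n)) \<le> ln (real_of_int A * real n ^ d)"
      using nz[of n] by (intro ln_mono) auto
    also have "\<dots> = ln A + d * ln (real n)" using A(1) that by (simp add: ln_mult ln_realpow)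
    finally show ?thesis .
  qed
  \<comment> \<open>\<open>ln 2\<close> is the loss for \<open>n \<ge> 2 * A\<close>; for smaller
    \<open>n\<close> the whole of \<open>d * ln n\<close> is at most
    \<open>d * ln (2 * A)\<close>.\<close>
  define C0 where "C0 = ln 2 + d * ln (2 * real_of_int A)"
  have lower: "d * ln (real n) - C0 \<le> ln (real (abs_value f n))" if "n \<ge> 1" for n
  proof (cases "int n \<ge> 2 * A")
    case True
    have "real n ^ d = real_of_int (int n ^ d)" by simp
    also have "\<dots> \<le> real_of_int (2 * \<bar>poly f (int n)\<bar>)" using A(3)[OF True] by (simp only: of_int_le_iff)
    also have "\<dots> = 2 * real (abs_value f n)" by (simp add: abs_value_def)
    finally have "ln (real n ^ d) \<le> ln (2 * real (abs_value f n))"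
      using that by (intro ln_mono) auto
    moreover have "d * ln (2 * real_of_int A) \<ge> 0" using A(1) by (intro mult_nonneg_nonneg ln_ge_zero) auto
    ultimately show ?thesis using that nz[of n] by (simp add: ln_realpow ln_mult C0_def)
  next
    case False
    then have "real n \<le> 2 * real_of_int A" by linarith
    then have "d * ln (real n) \<le> d * ln (2 * real_of_int A)"
      using that by (intro mult_left_mono ln_mono) auto
    moreover have "ln (real (abs_value f n)) \<ge> 0" using nz[of n] by simp
    moreover have "ln (2 :: real) \<ge> 0" by simp
    ultimately show ?thesis unfolding C0_def by linarith
  qed
  have "ln (real_of_int A) \<ge> 0" using A(1) by simp
  from sum_small_primes_le[OF assms(1-3) this upper[unfolded d_def]]
  obtain C2 where C2: "\<forall>N\<ge>1. (\<Sum>p | prime p \<and> p \<le> 2 * N. real (\<Sum>n=1..N. multiplicity p (abs_value f n)) * ln (real p))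
    \<le> real N * ln (real N) + C2 * real N" by blast
  define C where "C = \<bar>C2\<bar> + \<bar>C0\<bar> + d"
  have "C > 0" using d by (simp add: C_def)
  have "ln (real_of_int (lcm_values f N)) \<ge> 2 * (real d - 1) / real d * real N * ln (real N) - C * real N" if "N \<ge> 2" for N
  proof -
    have N: "N \<ge> 1" using that by simp
    define L where "L = nat (lcm_values f N)"
    have "lcm_values f N \<noteq> 0" unfolding lcm_values_def
      using irreducible_no_root[OF assms(2,3)] by (subst Lcm_0_iff) auto
    moreover have "lcm_values f N \<ge> 0" unfolding lcm_values_def by (rule Lcm_int_greater_eq_0)
    ultimately have L: "L > 0" "real L = real_of_int (lcm_values f N)" by (auto simp: L_def)
    have dvdL: "abs_value f n dvd L" if "n \<in> {1..N}" for n
    proof -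
      have "poly f (int n) dvd lcm_values f N" unfolding lcm_values_def using that by (intro dvd_Lcm) auto
      then show ?thesis by (simp add: abs_value_def L_def nat_dvd_iff abs_dvd_iff \<open>lcm_values f N \<ge> 0\<close>)
    qed
    define \<alpha> where "\<alpha> p = real (\<Sum>n=1..N. multiplicity p (abs_value f n)) * ln (real p)" for p
    \<comment> \<open>A cutoff above all prime factors of all values; the summand
      \<open>2 * N\<close> makes the small primes \<open>?Q\<close> a part of
      \<open>?P\<close>.\<close>
    define M where "M = 2 * N + (\<Sum>n=1..N. abs_value f n)"
    let ?P = "{p. prime p \<and> p \<le> M}" and ?Q = "{p. prime p \<and> p \<le> 2 * N}"
    let ?R = "{p. prime p \<and> 2 * N < p \<and> p \<le> M}"
    have finR: "finite ?R" by (rule finite_subset[OF _ finite_primes_le[of M]]) auto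
    have "(\<Sum>n=1..N. ln (real (abs_value f n))) = (\<Sum>n=1..N. \<Sum>p\<in>?P. real (multiplicity p (abs_value f n)) * ln (real p))"
    proof (rule sum.cong[OF refl], rule sum_multiplicity_ln_le(2)[symmetric])
      fix n p assume n: "n \<in> {1..N}" and p: "prime p" "p dvd abs_value f n"
      have "p \<le> abs_value f n" using p nz by (intro dvd_imp_le) auto
      also have "\<dots> \<le> (\<Sum>n=1..N. abs_value f n)" using n by (intro member_le_sum) auto
      finally show "p \<in> ?P" using p by (simp add: M_def)
    qed (use nz finite_primes_le in auto)
    also have "\<dots> = (\<Sum>p\<in>?P. \<alpha> p)"
      unfolding \<alpha>_def by (subst sum.swap) (simp add: sum_distrib_right)
    also have "?P = ?Q \<union> ?R" by (auto simp: M_def)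
    also have "(\<Sum>p\<in>?Q \<union> ?R. \<alpha> p) = (\<Sum>p\<in>?Q. \<alpha> p) + (\<Sum>p\<in>?R. \<alpha> p)"
      using finR finite_primes_le by (intro sum.union_disjoint) auto
    also have "(\<Sum>p\<in>?Q. \<alpha> p) \<le> real N * ln (real N) + C2 * real N"
      unfolding \<alpha>_def using C2 N by blast
    also have "(\<Sum>p\<in>?R. \<alpha> p) \<le> (\<Sum>p\<in>?R. d / 2 * (real (multiplicity p L) * ln (real p)))"
    proof (rule sum_mono)
      fix p assume p: "p \<in> ?R"
      then have "2 * (\<Sum>n=1..N. multiplicity p (abs_value f n)) \<le> d * multiplicity p L"
        unfolding d_def using assms L nz dvdL by (intro sum_multiplicity_even_poly_le) auto
      then have "real (2 * (\<Sum>n=1..N. multiplicity p (abs_value f n))) \<le> real (d * multiplicity p L)"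
        by (simp only: of_nat_le_iff)
      then have "real (\<Sum>n=1..N. multiplicity p (abs_value f n)) \<le> d / 2 * real (multiplicity p L)"
        by (simp only: of_nat_mult)
      then have "\<alpha> p \<le> d / 2 * real (multiplicity p L) * ln (real p)"
        unfolding \<alpha>_def using p by (intro mult_right_mono) (auto dest: prime_ge_1_nat)
      then show "\<alpha> p \<le> d / 2 * (real (multiplicity p L) * ln (real p))" by (simp add: mult.assoc)
    qed
    also have "\<dots> = d / 2 * (\<Sum>p\<in>?R. real (multiplicity p L) * ln (real p))"
      by (simp add: sum_distrib_left)
    also have "\<dots> \<le> d / 2 * ln (real L)"
      using L finR by (intro mult_left_mono sum_multiplicity_ln_le(1)) auto
    finally have up: "(\<Sum>n=1..N. ln (real (abs_value f n))) \<le> real N * ln (real N) + C2 * real N + d / 2 * ln (real L)"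
      by simp
    \<comment> \<open>Growth gives \<open>d N ln N\<close> from below; the small primes take one
      \<open>N ln N\<close> of it, and \<open>d - 1\<close> copies remain for
      \<open>ln L\<close>.\<close>
    have "d * (real N * ln (real N) - real N) \<le> d * (\<Sum>n=1..N. ln (real n))"
      by (intro mult_left_mono sum_ln_ge) auto
    also have "\<dots> = (\<Sum>n=1..N. d * ln (real n) - C0) + C0 * real N"
      by (simp add: sum_subtractf sum_distrib_left)
    also have "(\<Sum>n=1..N. d * ln (real n) - C0) \<le> (\<Sum>n=1..N. ln (real (abs_value f n)))"
      by (intro sum_mono lower) auto
    finally have "(real d - 1) * (real N * ln (real N)) - (C2 + C0 + d) * real N \<le> d / 2 * ln (real L)"
      using up by (simp add: algebra_simps)
    moreover have "(C2 + C0 + d) * real N \<le> C * real N"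
      unfolding C_def by (intro mult_right_mono) auto
    \<comment> \<open>With \<open>d \<ge> 2\<close> the error may be enlarged by
      \<open>d / 2\<close>, so that multiplying by \<open>2 / d\<close> returns exactly
      \<open>C * N\<close>.\<close>
    moreover have "C * real N \<le> d / 2 * (C * real N)"
      using mult_right_mono[of 1 "d / 2" "C * real N"] d \<open>C > 0\<close> by simp
    ultimately have "(real d - 1) * (real N * ln (real N)) \<le> d / 2 * (ln (real L) + C * real N)"
      by (simp add: distrib_left)
    then have "2 / d * ((real d - 1) * (real N * ln (real N))) \<le> 2 / d * (d / 2 * (ln (real L) + C * real N))"
      by (intro mult_left_mono) auto
    also have "\<dots> = ln (real L) + C * real N" using d by simp
    also have "2 / d * ((real d - 1) * (real N * ln (real N))) = 2 * (real d - 1) / real d * real N * ln (real N)"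
      by simp
    finally show ?thesis unfolding L(2)[symmetric] by linarith
  qed
  then show ?thesis using \<open>C > 0\<close> unfolding d_def by blast
qed

end
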